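(* Let $n,m\ge1$, $q\in(0,1)$, $a\in\mathbb{R}^n_{>0}$. For every $(Z,f)\in\mathbb{K}^{2n}\times\mathcal{O}_m(n)$ with $f=(f^0,\dots,f^m)$ and $z^{2n}=f^m$, \[\sum_{w\in[n,\bar n]^m}a^w\phi_w(Z,f)=a^Z\kappa_n(Z)\prod_{i=1}^mL_n(f^{i-1},f^i),\] where $a^w=\prod_{i=1}^m a_{w_i}$ with $a_{\bar l}=a_l^{-1}$.
   Context: $\Lambda_l$: weakly decreasing $l$-tuples of nonnegative integers; $|x|=\sum x_i$; $e_i$ unit vectors. For tuples $x,y$ (coordinates beyond length $=0$), $x\preceq y$ means $y_i\ge x_i\ge y_{i+1}$ for all $i$. $\mathbb{K}^{2n}$: patterns $Z=(z^1,\dots,z^{2n})$ with $z^{2l-1},z^{2l}\in\Lambda_l$ and $z^1\preceq\dots\preceq z^{2n}$; $\mathbf 0$ is the all-zero pattern. An oscillating tableau of length $m$ is $f=(f^0,\dots,f^m)$ of partitions with $f^0=\emptyset$ and consecutive partitions differing by adding or removing exactly one box; $\mathcal{O}_m(n)$ those with all $f^i\in\Lambda_n$. Alphabet $[n,\bar n]=\{1<\bar1<\dots<n<\bar n\}$, $\mathrm{order}(l)=2l-1$, $\mathrm{order}(\bar l)=2l$. $\binom{N}{k}_q=\frac{(q;q)_N}{(q;q)_k(q;q)_{N-k}}$, $(q;q)_k=\prod_{j=1}^k(1-q^j)$. $a^Z=\prod_{i=1}^na_i^{2|z^{2i-1}|-|z^{2i}|-|z^{2i-2}|}$ ($|z^0|=0$),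 $\kappa_n(Z)=\prod_{k=1}^n\Big[\Big(\prod_{i=1}^{k-1}\binom{z^{2k-1}_i-z^{2k-1}_{i+1}}{z^{2k-1}_i-z^{2k-2}_i}_q\binom{z^{2k}_i-z^{2k}_{i+1}}{z^{2k}_i-z^{2k-1}_i}_q\Big)\binom{z^{2k}_k}{z^{2k}_k-z^{2k-1}_k}_q\Big]$. $L_n(\lambda,\lambda+e_i)=u^+_{n,i}(\lambda)$, $L_n(\lambda,\lambda-e_i)=u^-_{n,i}(\lambda)$, $0$ otherwise, where $u^+_{n,1}=1$, $u^+_{n,i}(\lambda)=1-q^{\lambda_{i-1}-\lambda_i}$ ($1<i\le n$), $u^-_{n,i}(\lambda)=1-q^{\lambda_i-\lambda_{i+1}}$ ($i<n$), $u^-_{n,n}(\lambda)=1-q^{\lambda_n}$. $q$-Berele insertion: for interlacing $x\preceq y$, $r_i(y;x)=q^{y_i-x_i}\frac{1-q^{x_{i-1}-y_i}}{1-q^{x_{i-1}-x_i}}$, $l_i(y;x)=q^{x_i-y_{i+1}}\frac{1-q^{y_{i+1}-x_{i+1}}}{1-q^{x_i-x_{i+1}}}$ with $x_0=+\infty$ and coordinates beyond length $0$. Inserting letter $l$ into $Z$ makes $z^k_1$, $k=\mathrm{order}(l)$, attempt a right jump (increase by 1); moves propagate downward, with probabilities evaluated at the configuration of levels $k,k+1$ before $z^k_i$ moves. If $z^k_i$ attempts a right jump: if $k=2n$ it is performed; if $k$ odd and $i=(k+1)/2$, with probability $r_i(z^{k+1};z^k)$ it is performed and $z^{k+1}_i$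 attempts a right jump, otherwise it is suppressed and $z^{k+1}_i$ performs a left jump; otherwise it is performed and with probability $r_i(z^{k+1};z^k)$ $z^{k+1}_i$ attempts a right jump, else $z^{k+1}_{i+1}$ attempts a right jump. If $z^k_i$ performs a left jump and $k<2n$, then with probability $l_i(z^{k+1};z^k)$ $z^{k+1}_{i+1}$ performs a left jump, else $z^{k+1}_i$ does. $I_l(Z,\tilde Z)$ is the probability of reaching $\tilde Z$. Weights: for $w=w_1\cdots w_m$ and $f\in\mathcal{O}_m(n)$, $\phi_w(Z,f)=\sum\prod_{i=1}^mI_{w_i}(Z(i-1),Z(i))$, the sum over $Z(1),\dots,Z(m-1)\in\mathbb{K}^{2n}$ with $Z(0)=\mathbf 0$, $Z(m)=Z$, and $z^{2n}(i)=f^i$ for all $1\le i\le m$. *)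

theory Defs
  imports "HOL-Probability.Probability"
begin

text \<open>
  A tuple \<open>(x\<^sub>1, \<dots>, x\<^sub>l)\<close> of nonnegative integers is a function \<open>nat \<Rightarrow> nat\<close> that vanishes
  outside \<open>{1..l}\<close>, so "coordinates beyond the length are \<open>0\<close>" holds by construction.
  Index \<open>0\<close> is unused and also carries the value \<open>0\<close>; the convention \<open>x\<^sub>0 = \<infinity>\<close> of the insertion
  algorithm is treated as a separate case in \<open>r_prob\<close>.
\<close>

type_synonym tuple = "nat \<Rightarrow> nat"

definition Lam :: "nat \<Rightarrow> tuple set" where
  "Lam l = {x. (\<forall>i. i \<notin> {1..l} \<longrightarrow> x i = 0) \<and> (\<forall>i\<ge>1. x (Suc i) \<le> x i)}"

definition incr :: "tuple \<Rightarrow> nat \<Rightarrow> tuple" where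
  "incr x i = x(i := x i + 1)"

definition interlace :: "tuple \<Rightarrow> tuple \<Rightarrow> bool" where
  "interlace x y \<longleftrightarrow> (\<forall>i\<ge>1. y i \<ge> x i \<and> x i \<ge> y (Suc i))"

text \<open>
  A pattern maps a level \<open>k \<in> {1..2n}\<close> to the tuple \<open>z\<^sup>k\<close>; the remaining levels (in particular
  level \<open>0\<close>) are fixed to \<open>0\<close>, so that two patterns are equal iff they agree as functions.
  Level \<open>k\<close> has length \<open>(k + 1) div 2\<close>, i.e. length \<open>l\<close> for \<open>k = 2l - 1\<close> and \<open>k = 2l\<close>.
\<close>

type_synonym pattern = "nat \<Rightarrow> tuple"

definition level_length :: "nat \<Rightarrow> nat" where
  "level_length k = (k + 1) div 2"

definition zero_pattern :: pattern where
  "zero_pattern = (\<lambda>k i. 0)"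

definition KK :: "nat \<Rightarrow> pattern set" where
  "KK n = {Z. (\<forall>k\<in>{1..2*n}. Z k \<in> Lam (level_length k))
            \<and> (\<forall>k. k \<notin> {1..2*n} \<longrightarrow> Z k = (\<lambda>i. 0))
            \<and> (\<forall>k\<in>{1..<2*n}. interlace (Z k) (Z (Suc k)))}"

definition level_size :: "pattern \<Rightarrow> nat \<Rightarrow> int" where
  "level_size Z k = (\<Sum>i=1..level_length k. int (Z k i))"

definition osc_tableaux :: "nat \<Rightarrow> nat \<Rightarrow> tuple list set" where
  "osc_tableaux n m = {f. length f = Suc m \<and> f ! 0 = (\<lambda>i. 0) \<and> (\<forall>j\<le>m. f ! j \<in> Lam n)
      \<and> (\<forall>j<m. \<exists>i\<ge>1. f ! Suc j = incr (f ! j) i \<or> f ! j = incr (f ! Suc j) i)}"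

datatype letter = Unbarred nat | Barred nat

fun letter_order :: "letter \<Rightarrow> nat" where
  "letter_order (Unbarred l) = 2 * l - 1"
| "letter_order (Barred l) = 2 * l"

definition alphabet :: "nat \<Rightarrow> letter set" where
  "alphabet n = Unbarred ` {1..n} \<union> Barred ` {1..n}"

definition words :: "nat \<Rightarrow> nat \<Rightarrow> letter list set" where
  "words n m = {w. length w = m \<and> set w \<subseteq> alphabet n}"

fun letter_weight :: "(nat \<Rightarrow> real) \<Rightarrow> letter \<Rightarrow> real" where
  "letter_weight a (Unbarred l) = a l"
| "letter_weight a (Barred l) = inverse (a l)"

definition word_weight :: "(nat \<Rightarrow> real) \<Rightarrow> letter list \<Rightarrow> real" where
  "word_weight a w = (\<Prod>i<length w. letter_weight a (w ! i))"

definition q_poch :: "real \<Rightarrow> nat \<Rightarrow> real" where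
  "q_poch q k = (\<Prod>j=1..k. 1 - q ^ j)"

definition q_binom :: "real \<Rightarrow> nat \<Rightarrow> nat \<Rightarrow> real" where
  "q_binom q N k = q_poch q N / (q_poch q k * q_poch q (N - k))"

definition pattern_weight :: "nat \<Rightarrow> (nat \<Rightarrow> real) \<Rightarrow> pattern \<Rightarrow> real" where
  "pattern_weight n a Z =
     (\<Prod>i=1..n. a i powi (2 * level_size Z (2*i-1) - level_size Z (2*i) - level_size Z (2*i-2)))"

definition kappa :: "real \<Rightarrow> nat \<Rightarrow> pattern \<Rightarrow> real" where
  "kappa q n Z =
     (\<Prod>k=1..n.
        (\<Prod>i=1..k-1.
           q_binom q (Z (2*k-1) i - Z (2*k-1) (i+1)) (Z (2*k-1) i - Z (2*k-2) i)
         * q_binom q (Z (2*k) i - Z (2*k) (i+1)) (Z (2*k) i - Z (2*k-1) i))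
        * q_binom q (Z (2*k) k) (Z (2*k) k - Z (2*k-1) k))"

definition u_plus :: "real \<Rightarrow> nat \<Rightarrow> nat \<Rightarrow> tuple \<Rightarrow> real" where
  "u_plus q n i x = (if i = 1 then 1 else 1 - q ^ (x (i-1) - x i))"

definition u_minus :: "real \<Rightarrow> nat \<Rightarrow> nat \<Rightarrow> tuple \<Rightarrow> real" where
  "u_minus q n i x = (if i < n then 1 - q ^ (x i - x (i+1)) else 1 - q ^ x n)"

text \<open>
  At most one summand below is nonzero, since \<open>y = x + e\<^sub>i\<close> and \<open>y = x - e\<^sub>i\<close> exclude each other
  and determine \<open>i\<close>. The condition \<open>y = x - e\<^sub>i\<close> is expressed as \<open>x = y + e\<^sub>i\<close>, which avoids
  truncated subtraction.
\<close>

definition L_kernel :: "real \<Rightarrow> nat \<Rightarrow> tuple \<Rightarrow> tuple \<Rightarrow> real" where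
  "L_kernel q n x y =
     (\<Sum>i=1..n. (if y = incr x i then u_plus q n i x else 0)
             + (if x = incr y i then u_minus q n i x else 0))"

text \<open>For \<open>i = 1\<close> the second factor is \<open>1\<close> because \<open>x\<^sub>0 = \<infinity>\<close> and \<open>0 < q < 1\<close>.\<close>

definition r_prob :: "real \<Rightarrow> nat \<Rightarrow> tuple \<Rightarrow> tuple \<Rightarrow> real" where
  "r_prob q i y x =
     q ^ (y i - x i) * (if i = 1 then 1 else (1 - q ^ (x (i-1) - y i)) / (1 - q ^ (x (i-1) - x i)))"

definition l_prob :: "real \<Rightarrow> nat \<Rightarrow> tuple \<Rightarrow> tuple \<Rightarrow> real" where
  "l_prob q i y x =
     q ^ (x i - y (i+1)) * (1 - q ^ (y (i+1) - x (i+1))) / (1 - q ^ (x i - x (i+1)))"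

text \<open>
  The constant \<open>bernoulli_pmf\<close> truncates its argument to \<open>[0, 1]\<close>. The following two facts show
  that no truncation takes place for interlacing levels, even in the degenerate case of a
  vanishing denominator.
\<close>

lemma r_prob_in_unit:
  assumes "0 < q" "q < 1" "i \<ge> 1" "interlace x y"
  shows "r_prob q i y x \<in> {0..1}"
proof (cases "i = 1")
  case True
  then show ?thesis using assms by (auto simp: r_prob_def power_le_one)
next
  case False
  then have "i - 1 \<ge> 1" "Suc (i - 1) = i" using assms by auto
  then have "x i \<le> y i" "y i \<le> x (i-1)" using assms unfolding interlace_def by metis+
  then have "q ^ (x (i-1) - x i) \<le> q ^ (x (i-1) - y i)"
    using assms by (intro power_decreasing) auto
  then have "(1 - q ^ (x (i-1) - y i)) / (1 - q ^ (x (i-1) - x i)) \<in> {0..1}"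
    using assms by (auto simp: power_le_one divide_le_eq_1 intro!: divide_nonneg_nonneg)
      (meson assms less_eq_real_def not_less power_le_one)
  then show ?thesis using assms False
    by (auto simp: r_prob_def power_le_one mult_le_one simp flip: times_divide_eq_right)
qed

lemma l_prob_in_unit:
  assumes "0 < q" "q < 1" "i \<ge> 1" "interlace x y"
  shows "l_prob q i y x \<in> {0..1}"
proof -
  have "x i \<ge> y (i+1)" "y (i+1) \<ge> x (i+1)" using assms unfolding interlace_def by auto
  then have "q ^ (x i - x (i+1)) \<le> q ^ (y (i+1) - x (i+1))"
    using assms by (intro power_decreasing) auto
  then have "(1 - q ^ (y (i+1) - x (i+1))) / (1 - q ^ (x i - x (i+1))) \<in> {0..1}"
    using assms by (auto simp: power_le_one divide_le_eq_1 intro!: divide_nonneg_nonneg)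
      (meson assms less_eq_real_def not_less power_le_one)
  then show ?thesis using assms
    by (auto simp: l_prob_def power_le_one mult_le_one simp flip: times_divide_eq_right)
qed

definition move_right :: "pattern \<Rightarrow> nat \<Rightarrow> nat \<Rightarrow> pattern" where
  "move_right Z k i = Z(k := (Z k)(i := Z k i + 1))"

definition move_left :: "pattern \<Rightarrow> nat \<Rightarrow> nat \<Rightarrow> pattern" where
  "move_left Z k i = Z(k := (Z k)(i := Z k i - 1))"

text \<open>
  \<open>left_jump q n k i Z\<close> and \<open>right_jump q n k i Z\<close> are the laws of the final pattern when, in
  configuration \<open>Z\<close>, the entry \<open>z\<^sup>k\<^sub>i\<close> performs a left jump, respectively attempts a right jump.
  The natural-number subtraction in \<open>move_left\<close> never truncates on a branch of positive probability.
\<close>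

function left_jump :: "real \<Rightarrow> nat \<Rightarrow> nat \<Rightarrow> nat \<Rightarrow> pattern \<Rightarrow> pattern pmf" where
  "left_jump q n k i Z =
     (if k \<ge> 2 * n then return_pmf (move_left Z k i)
      else bind_pmf (bernoulli_pmf (l_prob q i (Z (k+1)) (Z k)))
        (\<lambda>b. if b then left_jump q n (k+1) (i+1) (move_left Z k i)
             else left_jump q n (k+1) i (move_left Z k i)))"
  by auto
termination by (relation "Wellfounded.measure (\<lambda>(q, n, k, i, Z). 2 * n - k)") auto

function right_jump :: "real \<Rightarrow> nat \<Rightarrow> nat \<Rightarrow> nat \<Rightarrow> pattern \<Rightarrow> pattern pmf" where
  "right_jump q n k i Z =
     (if k \<ge> 2 * n then return_pmf (move_right Z k i)
      else bind_pmf (bernoulli_pmf (r_prob q i (Z (k+1)) (Z k)))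
        (\<lambda>b. if b then right_jump q n (k+1) i (move_right Z k i)
             else if odd k \<and> i = (k+1) div 2 then left_jump q n (k+1) i Z
             else right_jump q n (k+1) (i+1) (move_right Z k i)))"
  by auto
termination by (relation "Wellfounded.measure (\<lambda>(q, n, k, i, Z). 2 * n - k)") auto

declare left_jump.simps [simp del] right_jump.simps [simp del]

definition insert_prob :: "real \<Rightarrow> nat \<Rightarrow> letter \<Rightarrow> pattern \<Rightarrow> pattern \<Rightarrow> real" where
  "insert_prob q n l Z Z' = pmf (right_jump q n (letter_order l) 1 Z) Z'"

text \<open>
  The list \<open>zs\<close> is \<open>Z(0), \<dots>, Z(m)\<close>. The index set of the sum in \<open>phi\<close> is finite
  (\<open>finite_pattern_paths\<close> below), so \<open>sum\<close> has its intended meaning.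
\<close>

definition pattern_paths :: "nat \<Rightarrow> nat \<Rightarrow> pattern \<Rightarrow> tuple list \<Rightarrow> pattern list set" where
  "pattern_paths n m Z f =
     {zs. length zs = Suc m \<and> zs ! 0 = zero_pattern \<and> zs ! m = Z
        \<and> (\<forall>i\<in>{1..<m}. zs ! i \<in> KK n) \<and> (\<forall>i\<in>{1..m}. (zs ! i) (2 * n) = f ! i)}"

definition phi :: "real \<Rightarrow> nat \<Rightarrow> letter list \<Rightarrow> pattern \<Rightarrow> tuple list \<Rightarrow> real" where
  "phi q n w Z f =
     (\<Sum>zs\<in>pattern_paths n (length w) Z f.
        \<Prod>i=1..length w. insert_prob q n (w ! (i-1)) (zs ! (i-1)) (zs ! i))"

lemma Lam_le_first:
  assumes "x \<in> Lam l" shows "x i \<le> x 1"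
proof (cases i)
  case 0
  then show ?thesis using assms by (simp add: Lam_def)
next
  case (Suc j)
  have "x (Suc j) \<le> x 1" for j
    by (induction j) (use assms in \<open>auto simp: Lam_def intro: order_trans\<close>)
  then show ?thesis using Suc by simp
qed

lemma KK_entry_le:
  assumes "Z \<in> KK n" "k \<le> 2 * n" shows "Z k i \<le> Z (2 * n) 1"
proof (cases "k = 0")
  case True
  then show ?thesis using assms by (simp add: KK_def)
next
  case False
  have "Z k 1 \<le> Z (2 * n) 1"
    using assms(2)
  proof (induction rule: inc_induct)
    case (step j)
    then have "interlace (Z j) (Z (Suc j))" using assms False by (simp add: KK_def)
    then have "Z j 1 \<le> Z (Suc j) 1" by (simp add: interlace_def)
    with step show ?case by simp
  qed simp
  moreover have "Z k i \<le> Z k 1"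
    using assms False by (intro Lam_le_first[of _ "level_length k"]) (simp add: KK_def)
  ultimately show ?thesis by simp
qed

lemma finite_KK_top: "finite {Z \<in> KK n. Z (2 * n) = g}"
proof -
  define X where "X = {x :: tuple. \<forall>i. (i \<in> {1..n} \<longrightarrow> x i \<in> {..g 1}) \<and> (i \<notin> {1..n} \<longrightarrow> x i = 0)}"
  define Y where "Y = {Z :: pattern. \<forall>k. (k \<in> {1..2*n} \<longrightarrow> Z k \<in> X)
                          \<and> (k \<notin> {1..2*n} \<longrightarrow> Z k = (\<lambda>i. 0))}"
  have "finite X" unfolding X_def by (intro finite_set_of_finite_funs) auto
  then have "finite Y" unfolding Y_def by (intro finite_set_of_finite_funs) auto
  moreover have "Z \<in> Y" if "Z \<in> KK n" "Z (2 * n) = g" for Z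
  proof -
    have "Z k i = 0" if "k \<in> {1..2*n}" "i \<notin> {1..n}" for k i
    proof -
      have "Z k \<in> Lam (level_length k)" using \<open>Z \<in> KK n\<close> that by (simp add: KK_def)
      moreover have "i \<notin> {1..level_length k}" using that by (auto simp: level_length_def)
      ultimately show ?thesis by (auto simp: Lam_def)
    qed
    moreover have "Z k i \<le> g 1" if "k \<in> {1..2*n}" for k i
      using KK_entry_le[of Z n k i] that \<open>Z \<in> KK n\<close> \<open>Z (2 * n) = g\<close> by auto
    ultimately show ?thesis
      using that unfolding Y_def X_def KK_def by blast
  qed
  ultimately show ?thesis by (auto intro: finite_subset)
qed

lemma finite_pattern_paths: "finite (pattern_paths n m Z f)"
proof -
  define A where "A = {zero_pattern, Z} \<union> (\<Union>j\<le>m. {Z \<in> KK n. Z (2 * n) = f ! j})"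
  have "set zs \<subseteq> A" if zs: "zs \<in> pattern_paths n m Z f" for zs
  proof
    fix z assume "z \<in> set zs"
    then obtain i where i: "i \<le> m" "z = zs ! i"
      using zs by (auto simp: in_set_conv_nth pattern_paths_def less_Suc_eq_le)
    show "z \<in> A"
    proof (cases "i = 0 \<or> i = m")
      case True
      then show ?thesis using i zs by (auto simp: A_def pattern_paths_def)
    next
      case False
      then have "z \<in> KK n" "z (2 * n) = f ! i"
        using i zs by (auto simp: pattern_paths_def)
      then show ?thesis using i by (auto simp: A_def)
    qed
  qed
  then have "pattern_paths n m Z f \<subseteq> {zs. set zs \<subseteq> A \<and> length zs = Suc m}"
    by (auto simp: pattern_paths_def)
  moreover have "finite A" by (auto simp: A_def finite_KK_top)
  ultimately show ?thesis by (blast intro: finite_subset finite_lists_length_eq)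
qed

end

theory Submission
  imports Defs
begin

text \<open>
  The weight \<open>a\<^sup>Z \<kappa>\<^sub>n(Z)\<close> is a product of one factor per pair of consecutive levels, each of them a
  product of weighted \<open>q\<close>-binomial coefficients, and the claim reduces to an intertwining relation
  for one insertion: summing weight times insertion probability over the letter and over the
  patterns \<open>Z\<close> with top level \<open>x\<close> gives \<open>L\<^sub>n(x, y)\<close> times the weight of the resulting pattern with top
  level \<open>y\<close>. Fix the resulting pattern and sum over the old configurations one level at a time,
  from the first level downwards. After the levels up to \<open>2l\<close>, the total mass that hands a right or
  left jump to coordinate \<open>i\<close> of level \<open>2l\<close> is \<open>u\<^sup>+\<^sub>l\<^sub>,\<^sub>i\<close> or \<open>u\<^sup>-\<^sub>l\<^sub>,\<^sub>i\<close> times the weight of the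
  new pattern; the passage through one further level is a pair of \<open>q\<close>-Pascal rules. The factors \<open>u\<^sup>\<plusminus>\<close>
  cancel the denominators of the jump probabilities. At odd levels the mass at the last coordinate
  does not have this simple form, but the suppressed right jumps restore it one level further down.
\<close>

section \<open>Weighted \<open>q\<close>-binomial coefficients\<close>

text \<open>The new pattern is fixed rather than the old one because then every jump leaves a single
  candidate for the old level \<open>k\<close>: \<open>W k\<close> with one entry shifted back, or
  \<open>W k\<close> itself after a suppressed jump. Each one-level sum thus has at most one term
  per kind of move and coordinate. A candidate may fail to be a partition or to interlace; over
  integer tuples, with q-binomials that are 0 outside their range, it simply has weight 0 and
  boundary cases disappear. Letters enter through a coincidence: the letter of order
  \<open>k\<close> has the same weight \<open>b\<close> whose powers occur at level
  \<open>k\<close>. A new letter contributes \<open>b\<close> times the weight of the unmoved pair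
  of levels, which is the term that the q-Pascal rule at coordinate 1 would otherwise lack. The
  obstacle is the coordinate that an odd level adds. It can receive left jumps only from the
  preceding coordinate of the level before, so one of the two terms of the left identity is missing.
  This forces the induction to advance by two levels at a time.\<close>

definition qbin :: "real \<Rightarrow> int \<Rightarrow> int \<Rightarrow> real" where
  "qbin q N k = (if 0 \<le> k \<and> k \<le> N then q_binom q (nat N) (nat k) else 0)"

lemma q_poch_Suc: "q_poch q (Suc k) = q_poch q k * (1 - q ^ Suc k)"
  by (simp add: q_poch_def)

lemma q_poch_nonzero:
  assumes "0 < q" "q < 1"
  shows "q_poch q k \<noteq> 0"
proof -
  have "q ^ j < 1" if "j \<ge> 1" for j
    using assms that power_Suc_less_one[of q "j - 1"] by simp
  then show ?thesis by (fastforce simp: q_poch_def)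
qed

lemma qbin_absorb:
  assumes "0 < q" "q < 1"
  shows "(1 - q powi k) * qbin q N k = (1 - q powi N) * qbin q (N - 1) (k - 1)"
proof (cases "1 \<le> k \<and> k \<le> N")
  case True
  define b where "b = nat (k - 1)"
  define c where "c = nat (N - k)"
  have *: "k = int (Suc b)" "N = int (Suc (b + c))"
    using True by (auto simp: b_def c_def)
  have "1 - q ^ Suc b \<noteq> 0"
    using q_poch_nonzero[OF assms, of "Suc b"] by (simp add: q_poch_Suc del: power_Suc)
  moreover have "qbin q N k = q_poch q (b + c) * (1 - q ^ Suc (b + c)) / (q_poch q b * (1 - q ^ Suc b) * q_poch q c)"
    unfolding *(1,2) qbin_def q_binom_def nat_int by (simp add: q_poch_Suc del: power_Suc of_nat_Suc)
  moreover have "qbin q (N - 1) (k - 1) = q_poch q (b + c) / (q_poch q b * q_poch q c)"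
  proof -
    have "N - 1 = int (b + c)" "k - 1 = int b" using * by auto
    then show ?thesis by (simp only: qbin_def q_binom_def nat_int) simp
  qed
  moreover have "q powi k = q ^ Suc b" "q powi N = q ^ Suc (b + c)"
    unfolding *(1,2) by (simp_all only: power_int_of_nat)
  ultimately show ?thesis by simp
next
  case False
  then show ?thesis by (auto simp: qbin_def)
qed

lemma qbin_sym: "qbin q N k = qbin q N (N - k)"
proof (cases "0 \<le> k \<and> k \<le> N")
  case True
  then have "nat N - nat k = nat (N - k)" "nat N - nat (N - k) = nat k" by auto
  then show ?thesis using True by (simp add: qbin_def q_binom_def)
qed (auto simp: qbin_def)

lemma qbin_absorb_comp:
  assumes "0 < q" "q < 1"
  shows "(1 - q powi (N - k)) * qbin q N k = (1 - q powi N) * qbin q (N - 1) k"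
  using qbin_absorb[OF assms, of "N - k" N] qbin_sym[of q N k] qbin_sym[of q "N - 1" k]
  by (simp add: algebra_simps)

lemma powi_eq_1_iff_real:
  assumes "0 < q" "q < (1::real)"
  shows "q powi k = 1 \<longleftrightarrow> k = 0"
proof
  assume *: "q powi k = 1"
  have "q powi k < 1" if "k > 0"
    using assms that by (simp add: power_int_def power_less_one_iff)
  moreover have "q powi (-k) < 1" if "k < 0"
    using assms that by (simp add: power_int_def power_less_one_iff)
  moreover have "q powi (-k) = 1" using * by (simp add: power_int_minus)
  ultimately show "k = 0" using * by (cases k "0::int" rule: linorder_cases) auto
qed auto

text \<open>By the two absorption rules the claim, multiplied by \<open>1 - q powi (N + 1)\<close>,
  becomes (1 - q^k) + q^k (1 - q^(N+1-k)) = 1 - q^(N+1). The bound on \<open>N\<close> makes this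
  factor cancellable; for N = -1 and k = 0 the two sides would be 1 and 0.\<close>

lemma qbin_pascal:
  assumes "0 < q" "q < 1" "0 \<le> N"
  shows "qbin q (N + 1) k = qbin q N (k - 1) + q powi k * qbin q N k"
proof -
  have "(1 - q powi (N + 1)) * qbin q N (k - 1) = (1 - q powi k) * qbin q (N + 1) k"
    using qbin_absorb[OF assms(1,2), of k "N + 1"] by simp
  moreover have "(1 - q powi (N + 1)) * qbin q N k = (1 - q powi (N + 1 - k)) * qbin q (N + 1) k"
    using qbin_absorb_comp[OF assms(1,2), of "N + 1" k] by simp
  moreover have "q powi k * q powi (N + 1 - k) = q powi (N + 1)"
    using assms by (simp flip: power_int_add)
  ultimately have "(1 - q powi (N + 1)) * (qbin q N (k - 1) + q powi k * qbin q N k)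
      = (1 - q powi (N + 1)) * qbin q (N + 1) k"
    by algebra
  moreover have "1 - q powi (N + 1) \<noteq> 0" using powi_eq_1_iff_real[OF assms(1,2), of "N + 1"] assms by auto
  ultimately show ?thesis by simp
qed

text \<open>For fixed \<open>N\<close> these are the terms of the Rogers-Szego polynomial in
  \<open>b\<close>.\<close>

definition qw :: "real \<Rightarrow> real \<Rightarrow> int \<Rightarrow> int \<Rightarrow> real" where
  "qw b q N k = b powi k * qbin q N k"

context
  fixes b q :: real
  assumes b: "b > 0" and q: "0 < q" "q < 1"
begin

lemma qw_absorb: "(1 - q powi k) * qw b q N k = b * (1 - q powi N) * qw b q (N - 1) (k - 1)"
proof -
  have "b powi k = b * b powi (k - 1)" using b power_int_add[of b 1 "k - 1"] by simp
  then show ?thesis using qbin_absorb[OF q, of k N] by (simp add: qw_def)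
qed

lemma qw_absorb_comp: "(1 - q powi (N - k)) * qw b q N k = (1 - q powi N) * qw b q (N - 1) k"
  using qbin_absorb_comp[OF q, of N k] by (simp add: qw_def)

lemma qw_pascal: "0 \<le> N \<Longrightarrow> qw b q (N + 1) k = b * qw b q N (k - 1) + q powi k * qw b q N k"
proof -
  have "b powi k = b * b powi (k - 1)" using b power_int_add[of b 1 "k - 1"] by simp
  then show "0 \<le> N \<Longrightarrow> ?thesis" using qbin_pascal[OF q, of N k] by (simp add: qw_def algebra_simps)
qed

text \<open>The reflection k -> N + 1 - k of the first Pascal rule. Right jumps use the first rule,
  left jumps this one.\<close>

lemma qw_pascal':
  assumes "0 \<le> N"
  shows "qw b q (N + 1) k = qw b q N k + b * q powi (N - k + 1) * qw b q N (k - 1)"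
proof -
  have "qbin q (N + 1) k = qbin q N k + q powi (N - k + 1) * qbin q N (k - 1)"
    using qbin_pascal[OF q assms, of "N + 1 - k"] qbin_sym[of q "N + 1" k] qbin_sym[of q N k]
      qbin_sym[of q N "k - 1"] by (simp add: algebra_simps)
  moreover have "b powi k = b * b powi (k - 1)" using b power_int_add[of b 1 "k - 1"] by simp
  ultimately show ?thesis by (simp add: qw_def algebra_simps)
qed

end

lemma qw_eq_0: "\<not> (0 \<le> k \<and> k \<le> N) \<Longrightarrow> qw b q N k = 0"
  by (auto simp: qw_def qbin_def)

section \<open>Weights of pairs of levels\<close>

text \<open>For interlacing partitions of length at most \<open>L\<close> this is the skew
  q-Whittaker function of shape y/x in the single variable \<open>b\<close>.\<close>

definition step_weight :: "real \<Rightarrow> real \<Rightarrow> nat \<Rightarrow> (nat \<Rightarrow> int) \<Rightarrow> (nat \<Rightarrow> int) \<Rightarrow> real" where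
  "step_weight b q L x y = (\<Prod>i=1..L. qw b q (y i - y (Suc i)) (y i - x i))"

lemma step_weight_nonzero:
  assumes "step_weight b q L x y \<noteq> 0" "i \<in> {1..L}"
  shows "x i \<le> y i" "y (Suc i) \<le> x i"
  using assms qw_eq_0[of "y i - x i" "y i - y (Suc i)" b q]
  by (force simp: step_weight_def)+

definition shift_at :: "(nat \<Rightarrow> int) \<Rightarrow> nat \<Rightarrow> int \<Rightarrow> nat \<Rightarrow> int" where
  "shift_at x i d = x(i := x i + d)"

lemma shift_at_simps [simp]: "shift_at x i d i = x i + d" "j \<noteq> i \<Longrightarrow> shift_at x i d j = x j"
  by (auto simp: shift_at_def)

lemma prod_split_pair:
  fixes g :: "nat \<Rightarrow> 'a::comm_monoid_mult"
  assumes "1 \<le> i" "Suc i \<le> L"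
  shows "(\<Prod>j=1..L. g j) = g i * g (Suc i) * (\<Prod>j\<in>{1..L}-{i,Suc i}. g j)"
proof -
  have "(\<Prod>j=1..L. g j) = g i * (\<Prod>j\<in>{1..L}-{i}. g j)"
    using assms by (intro prod.remove) auto
  also have "(\<Prod>j\<in>{1..L}-{i}. g j) = g (Suc i) * (\<Prod>j\<in>{1..L}-{i}-{Suc i}. g j)"
    using assms by (intro prod.remove) auto
  also have "{1..L}-{i}-{Suc i} = {1..L}-{i,Suc i}" by auto
  finally show ?thesis by (simp add: mult.assoc)
qed

text \<open>Coordinate \<open>i + 1\<close> of \<open>y\<close> receives jumps from coordinates
  \<open>i\<close> and \<open>i + 1\<close> of \<open>x\<close>. Only the factors at these two
  positions feel such a move; the remaining product is common to all terms of the identities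
  below.\<close>

lemma step_weight_split_pair:
  assumes "1 \<le> i" "Suc i \<le> L"
    and "\<And>j. j \<notin> {i, Suc i} \<Longrightarrow> x' j = x j" "\<And>j. j \<noteq> Suc i \<Longrightarrow> y' j = y j"
  shows "step_weight b q L x' y' =
    qw b q (y i - y' (Suc i)) (y i - x' i) * qw b q (y' (Suc i) - y (Suc (Suc i))) (y' (Suc i) - x' (Suc i))
    * (\<Prod>j\<in>{1..L}-{i,Suc i}. qw b q (y j - y (Suc j)) (y j - x j))"
proof -
  have "(\<Prod>j\<in>{1..L}-{i,Suc i}. qw b q (y' j - y' (Suc j)) (y' j - x' j))
     = (\<Prod>j\<in>{1..L}-{i,Suc i}. qw b q (y j - y (Suc j)) (y j - x j))"
    using assms by (intro prod.cong) auto
  then show ?thesis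
    unfolding step_weight_def prod_split_pair[OF assms(1,2)] using assms(4) by simp
qed

lemma step_weight_split_first:
  assumes "1 \<le> L"
    and "\<And>j. j \<noteq> 1 \<Longrightarrow> x' j = x j" "\<And>j. j \<noteq> 1 \<Longrightarrow> y' j = y j"
  shows "step_weight b q L x' y' =
    qw b q (y' 1 - y 2) (y' 1 - x' 1) * (\<Prod>j\<in>{1..L}-{1}. qw b q (y j - y (Suc j)) (y j - x j))"
proof -
  have "(\<Prod>j\<in>{1..L}-{1}. qw b q (y' j - y' (Suc j)) (y' j - x' j))
     = (\<Prod>j\<in>{1..L}-{1}. qw b q (y j - y (Suc j)) (y j - x j))"
    using assms by (intro prod.cong) auto
  moreover have "step_weight b q L x' y' = qw b q (y' 1 - y' (Suc 1)) (y' 1 - x' 1)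
      * (\<Prod>j\<in>{1..L}-{1}. qw b q (y' j - y' (Suc j)) (y' j - x' j))"
    unfolding step_weight_def using assms by (intro prod.remove) auto
  ultimately show ?thesis using assms(3) by (simp add: numeral_2_eq_2)
qed

section \<open>q-Pascal identities for a jump between two levels\<close>

context
  fixes b q :: real and L :: nat and x y :: "nat \<Rightarrow> int"
  assumes b: "b > 0" and q: "0 < q" "q < 1" and y: "\<And>i. i \<ge> 1 \<Longrightarrow> y (Suc i) \<le> y i"
begin

abbreviation (input) "psi \<equiv> step_weight b q L"

text \<open>Pascal rule at position 1. The first term is a jump of x_1 handed on to y_1, the second
  a new letter that starts at y_1 and leaves \<open>x\<close> alone.\<close>

lemma right_first:
  assumes "1 \<le> L"
  shows "q powi (y 1 - x 1 + 1) * psi (shift_at x 1 (-1)) y + b * psi x y = psi x (shift_at y 1 1)"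
proof -
  define N where "N = y 1 - y 2"
  define k where "k = y 1 - x 1 + 1"
  define R where "R = (\<Prod>j\<in>{1..L}-{1}. qw b q (y j - y (Suc j)) (y j - x j))"
  have "0 \<le> N" using y[of 1] by (simp add: N_def numeral_2_eq_2)
  then have "qw b q (N + 1) k = b * qw b q N (k - 1) + q powi k * qw b q N k"
    by (rule qw_pascal[OF b q])
  moreover have "psi (shift_at x 1 (-1)) y = qw b q N k * R"
    using assms by (subst step_weight_split_first[of L _ x _ y])
      (auto simp: N_def k_def R_def algebra_simps)
  moreover have "psi x y = qw b q N (k - 1) * R"
    using assms by (subst step_weight_split_first[of L _ x _ y])
      (auto simp: N_def k_def R_def algebra_simps)
  moreover have "psi x (shift_at y 1 1) = qw b q (N + 1) k * R"
    using assms by (subst step_weight_split_first[of L _ x _ y])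
      (auto simp: N_def k_def R_def algebra_simps)
  ultimately show ?thesis
    unfolding k_def[symmetric] by algebra
qed

text \<open>Jumps of x_(i+1) handed to the same coordinate and jumps of x_i handed to the next one,
  already multiplied by the factor u of the old level. Absorption at position \<open>i\<close> turns
  both terms into multiples of \<open>(1 - q powi M) * qw b q (M - 1) j\<close>; the Pascal rule at
  position \<open>i + 1\<close> adds them up.\<close>

lemma right_next:
  assumes "1 \<le> i" "Suc i \<le> L"
  shows "q powi (y (Suc i) - x (Suc i) + 1) * (1 - q powi (x i - y (Suc i))) * psi (shift_at x (Suc i) (-1)) y
       + (1 - q powi (y i - x i + 1)) * psi (shift_at x i (-1)) y
       = (1 - q powi (y i - y (Suc i))) * psi x (shift_at y (Suc i) 1)"
proof -
  define M where "M = y i - y (Suc i)"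
  define j where "j = y i - x i"
  define N where "N = y (Suc i) - y (Suc (Suc i))"
  define k where "k = y (Suc i) - x (Suc i) + 1"
  define R where "R = (\<Prod>j\<in>{1..L}-{i,Suc i}. qw b q (y j - y (Suc j)) (y j - x j))"
  have "0 \<le> N" using y[of "Suc i"] by (simp add: N_def)
  then have p: "qw b q (N + 1) k = b * qw b q N (k - 1) + q powi k * qw b q N k"
    by (rule qw_pascal[OF b q])
  have a1: "(1 - q powi (j + 1)) * qw b q M (j + 1) = b * (1 - q powi M) * qw b q (M - 1) j"
    using qw_absorb[OF b q, of "j + 1" M] by simp
  have a2: "(1 - q powi (M - j)) * qw b q M j = (1 - q powi M) * qw b q (M - 1) j"
    by (rule qw_absorb_comp[OF b q])
  have "q powi k * (1 - q powi (M - j)) * (qw b q M j * qw b q N k)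
      + (1 - q powi (j + 1)) * (qw b q M (j + 1) * qw b q N (k - 1))
      = (1 - q powi M) * (qw b q (M - 1) j * qw b q (N + 1) k)"
    unfolding p using a1 a2 by algebra
  moreover have "psi (shift_at x (Suc i) (-1)) y = qw b q M j * qw b q N k * R"
    using assms by (subst step_weight_split_pair[of i L _ x _ y])
      (auto simp: M_def j_def N_def k_def R_def algebra_simps)
  moreover have "psi (shift_at x i (-1)) y = qw b q M (j + 1) * qw b q N (k - 1) * R"
    using assms by (subst step_weight_split_pair[of i L _ x _ y])
      (auto simp: M_def j_def N_def k_def R_def algebra_simps)
  moreover have "psi x (shift_at y (Suc i) 1) = qw b q (M - 1) j * qw b q (N + 1) k * R"
    using assms by (subst step_weight_split_pair[of i L _ x _ y])
      (auto simp: M_def j_def N_def k_def R_def algebra_simps)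
  moreover have E: "x i - y (Suc i) = M - j" by (simp add: M_def j_def)
  ultimately show ?thesis
    unfolding E M_def[symmetric] j_def[symmetric] k_def[symmetric] by algebra
qed

text \<open>No letter starts with a left jump and no coordinate precedes the first, so there is a
  single term and absorption alone suffices.\<close>

lemma left_first:
  assumes "1 \<le> L"
  shows "(1 - q powi (x 1 + 1 - y 2)) * psi (shift_at x 1 1) y
       = (1 - q powi (y 1 - y 2)) * psi x (shift_at y 1 (-1))"
proof -
  define N where "N = y 1 - y 2"
  define k where "k = y 1 - x 1 - 1"
  define R where "R = (\<Prod>j\<in>{1..L}-{1}. qw b q (y j - y (Suc j)) (y j - x j))"
  have "(1 - q powi (N - k)) * qw b q N k = (1 - q powi N) * qw b q (N - 1) k"
    by (rule qw_absorb_comp[OF b q])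
  moreover have "psi (shift_at x 1 1) y = qw b q N k * R"
    using assms by (subst step_weight_split_first[of L _ x _ y])
      (auto simp: N_def k_def R_def algebra_simps)
  moreover have "psi x (shift_at y 1 (-1)) = qw b q (N - 1) k * R"
    using assms by (subst step_weight_split_first[of L _ x _ y])
      (auto simp: N_def k_def R_def algebra_simps)
  moreover have E: "x 1 + 1 - y 2 = N - k" by (simp add: N_def k_def)
  ultimately show ?thesis
    unfolding E N_def[symmetric] by algebra
qed

text \<open>The mirror image of \<open>right_next\<close>: absorption acts at position
  \<open>i + 1\<close> and the Pascal rule at position \<open>i\<close>.\<close>

lemma left_next:
  assumes "1 \<le> i" "Suc i \<le> L"
  shows "(1 - q powi (x (Suc i) + 1 - y (Suc (Suc i)))) * psi (shift_at x (Suc i) 1) y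
       + q powi (x i + 1 - y (Suc i)) * (1 - q powi (y (Suc i) - x (Suc i))) * psi (shift_at x i 1) y
       = (1 - q powi (y (Suc i) - y (Suc (Suc i)))) * psi x (shift_at y (Suc i) (-1))"
proof -
  define M where "M = y i - y (Suc i)"
  define j where "j = y i - x i"
  define N where "N = y (Suc i) - y (Suc (Suc i))"
  define k where "k = y (Suc i) - x (Suc i)"
  define R where "R = (\<Prod>j\<in>{1..L}-{i,Suc i}. qw b q (y j - y (Suc j)) (y j - x j))"
  have "0 \<le> M" using y[of i] assms by (simp add: M_def)
  then have p: "qw b q (M + 1) j = qw b q M j + b * q powi (M - j + 1) * qw b q M (j - 1)"
    by (rule qw_pascal'[OF b q])
  have a1: "(1 - q powi k) * qw b q N k = b * (1 - q powi N) * qw b q (N - 1) (k - 1)"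
    by (rule qw_absorb[OF b q])
  have a2: "(1 - q powi (N - k + 1)) * qw b q N (k - 1) = (1 - q powi N) * qw b q (N - 1) (k - 1)"
    using qw_absorb_comp[OF b q, of N "k - 1"] by (simp add: algebra_simps)
  have "(1 - q powi (N - k + 1)) * (qw b q M j * qw b q N (k - 1))
      + q powi (M - j + 1) * (1 - q powi k) * (qw b q M (j - 1) * qw b q N k)
      = (1 - q powi N) * (qw b q (M + 1) j * qw b q (N - 1) (k - 1))"
    unfolding p using a1 a2 by algebra
  moreover have "psi (shift_at x (Suc i) 1) y = qw b q M j * qw b q N (k - 1) * R"
    using assms by (subst step_weight_split_pair[of i L _ x _ y])
      (auto simp: M_def j_def N_def k_def R_def algebra_simps)
  moreover have "psi (shift_at x i 1) y = qw b q M (j - 1) * qw b q N k * R"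
    using assms by (subst step_weight_split_pair[of i L _ x _ y])
      (auto simp: M_def j_def N_def k_def R_def algebra_simps)
  moreover have "psi x (shift_at y (Suc i) (-1)) = qw b q (M + 1) j * qw b q (N - 1) (k - 1) * R"
    using assms by (subst step_weight_split_pair[of i L _ x _ y])
      (auto simp: M_def j_def N_def k_def R_def algebra_simps)
  moreover have E: "x i + 1 - y (Suc i) = M - j + 1" "x (Suc i) + 1 - y (Suc (Suc i)) = N - k + 1"
    by (simp_all add: M_def j_def N_def k_def)
  ultimately show ?thesis
    unfolding E N_def[symmetric] k_def[symmetric] by algebra
qed

end

section \<open>Transitions between levels\<close>

definition ints :: "tuple \<Rightarrow> nat \<Rightarrow> int" where
  "ints x i = int (x i)"

lemma ints_inject: "ints x = ints y \<longleftrightarrow> x = y"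
  by (auto simp: ints_def fun_eq_iff)

lemma ints_incr: "ints (incr x i) = shift_at (ints x) i 1"
  by (auto simp: ints_def incr_def shift_at_def)

lemma eq_incr_iff_ints: "x = incr v i \<longleftrightarrow> ints v = shift_at (ints x) i (-1)"
proof -
  have "x = incr v i \<longleftrightarrow> ints x = shift_at (ints v) i 1" by (metis ints_inject ints_incr)
  also have "\<dots> \<longleftrightarrow> ints v = shift_at (ints x) i (-1)"
    by (auto simp: shift_at_def fun_eq_iff)
  finally show ?thesis .
qed

definition below :: "nat \<Rightarrow> tuple \<Rightarrow> tuple set" where
  "below l y = {x \<in> Lam l. interlace x y}"

lemma finite_below: "finite (below l y)"
proof -
  define B where "B = Max (y ` {1..l})"
  have "x i \<le> B" if "x \<in> below l y" "i \<in> {1..l}" for x i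
  proof -
    have "x i \<le> y i" using that by (simp add: below_def interlace_def)
    also have "y i \<le> B" unfolding B_def using that by (intro Max_ge) simp_all
    finally show ?thesis .
  qed
  moreover have "x i = 0" if "x \<in> below l y" "i \<notin> {1..l}" for x i
    using that by (simp add: below_def Lam_def)
  ultimately have "below l y \<subseteq> {x. \<forall>i. (i \<in> {1..l} \<longrightarrow> x i \<in> {..B}) \<and> (i \<notin> {1..l} \<longrightarrow> x i = 0)}"
    by blast
  then show ?thesis by (rule finite_subset) (intro finite_set_of_finite_funs finite_atMost finite_atLeastAtMost)
qed

text \<open>At most one \<open>v\<close> is selected. If the integer tuple \<open>X\<close> does not
  come from any such \<open>v\<close>, for instance because an entry is -1, the step weight on the
  right is 0 as well, so callers need no case distinction.\<close>

lemma sum_below_collapse: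
  assumes y: "y \<in> Lam L" and "l \<le> L" and X: "\<And>j. j \<notin> {1..l} \<Longrightarrow> X j = 0"
    and F: "\<And>v. v \<in> below l y \<Longrightarrow> ints v = X \<Longrightarrow> F v = G"
  shows "(\<Sum>v\<in>below l y. of_bool (ints v = X) * F v * step_weight b q L (ints v) (ints y))
    = G * step_weight b q L X (ints y)"
proof (cases "step_weight b q L X (ints y) = 0")
  case True
  then show ?thesis by (intro trans[OF sum.neutral]) auto
next
  case False
  have il: "X i \<le> int (y i) \<and> int (y (Suc i)) \<le> X i" if "i \<ge> 1" for i
    using step_weight_nonzero[OF False, of i] X[of i] y \<open>l \<le> L\<close> that
    by (cases "i \<le> L") (auto simp: ints_def Lam_def)
  define v where "v i = nat (X i)" for i
  have "ints v = X"
  proof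
    fix i show "ints v i = X i" using il[of i] X[of i] by (cases i) (auto simp: ints_def v_def)
  qed
  have "int (v i) = X i" for i using \<open>ints v = X\<close> by (metis ints_def)
  then have le: "v i \<le> y i \<and> y (Suc i) \<le> v i" if "i \<ge> 1" for i
    using il[OF that] by (metis of_nat_le_iff)
  have "v (Suc i) \<le> v i" if "i \<ge> 1" for i
    using le[of i] le[of "Suc i"] that by linarith
  moreover have "v i = 0" if "i \<notin> {1..l}" for i using X[OF that] by (simp add: v_def)
  ultimately have v: "v \<in> below l y" using le by (simp add: below_def Lam_def interlace_def)
  have "ints u = X \<longleftrightarrow> u = v" for u using ints_inject \<open>ints v = X\<close> by metis
  then have "(\<Sum>u\<in>below l y. of_bool (ints u = X) * F u * step_weight b q L (ints u) (ints y))
      = (\<Sum>u\<in>below l y. if u = v then F v * step_weight b q L (ints v) (ints y) else 0)"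
    by (intro sum.cong) simp_all
  then show ?thesis using v F[OF v] \<open>ints v = X\<close> by (simp add: finite_below)
qed

section \<open>Cancellation of the denominators of the jump probabilities\<close>

definition up :: "real \<Rightarrow> nat \<Rightarrow> (nat \<Rightarrow> int) \<Rightarrow> real" where
  "up q i x = (if i = 1 then 1 else 1 - q powi (x (i - 1) - x i))"

definition um :: "real \<Rightarrow> nat \<Rightarrow> (nat \<Rightarrow> int) \<Rightarrow> real" where
  "um q i x = 1 - q powi (x i - x (Suc i))"

lemma powi_nat_diff: "n \<le> m \<Longrightarrow> (q::real) powi (int m - int n) = q ^ (m - n)"
  by (metis of_nat_diff power_int_of_nat)

lemma u_plus_eq_up:
  assumes "x \<in> Lam l" "i \<ge> 1"
  shows "u_plus q n i x = up q i (ints x)"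
proof (cases "i = 1")
  case False
  then obtain j where "i = Suc j" "j \<ge> 1" using assms by (cases i) auto
  then have "x i \<le> x (i - 1)" using assms by (auto simp: Lam_def)
  then show ?thesis using False by (simp add: u_plus_def up_def ints_def powi_nat_diff)
qed (simp add: u_plus_def up_def)

lemma u_minus_eq_um:
  assumes "x \<in> Lam n" "i \<in> {1..n}"
  shows "u_minus q n i x = um q i (ints x)"
proof -
  have "x (Suc i) \<le> x i" using assms by (auto simp: Lam_def)
  moreover have "x (Suc n) = 0" using assms by (auto simp: Lam_def)
  ultimately show ?thesis
    using assms powi_nat_diff[of "x (Suc i)" "x i" q] powi_nat_diff[of 0 "x i" q]
    by (cases "i < n") (auto simp: u_minus_def um_def ints_def dest: not_less_iff_gr_or_eq[THEN iffD1])
qed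

context
  fixes q :: real and v y :: tuple and i :: nat
  assumes q: "0 < q" "q < 1" and i: "1 \<le> i" and vy: "interlace v y"
begin

text \<open>For i > 1 the factor \<open>up q i (ints v)\<close> is the denominator of r_i. If it is
  0, then v_(i-1) = v_i, interlacing squeezes y_i to the same value and the right-hand side vanishes
  too, so division by zero is harmless.\<close>

lemma up_r_prob:
  "up q i (ints v) * r_prob q i y v = q powi (ints y i - ints v i) *
    (if i = 1 then 1 else 1 - q powi (ints v (i - 1) - ints y i))"
proof (cases "i = 1")
  case True
  then show ?thesis using vy by (simp add: up_def r_prob_def interlace_def ints_def powi_nat_diff)
next
  case False
  then have "Suc (i - 1) = i" "i - 1 \<ge> 1" using i by auto
  then have le: "v i \<le> y i" "y i \<le> v (i - 1)" using vy i unfolding interlace_def by metis+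
  show ?thesis
  proof (cases "v (i - 1) = v i")
    case True
    then show ?thesis using le False by (simp add: up_def ints_def)
  next
    case neq: False
    then have "1 - q ^ (v (i - 1) - v i) \<noteq> 0"
      using le powi_eq_1_iff_real[OF q, of "int (v (i - 1) - v i)"] by (simp add: power_int_of_nat del: of_nat_diff)
    then show ?thesis using le False by (simp add: up_def ints_def r_prob_def powi_nat_diff)
  qed
qed

lemma up_not_r_prob:
  "up q i (ints v) * (1 - r_prob q i y v) = 1 - q powi (ints y i - ints v i)"
proof (cases "i = 1")
  case True
  then show ?thesis using vy by (simp add: up_def r_prob_def interlace_def ints_def powi_nat_diff)
next
  case False
  have "q powi (ints y i - ints v i) * q powi (ints v (i - 1) - ints y i) = q powi (ints v (i - 1) - ints v i)"
    using q by (simp flip: power_int_add)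
  then show ?thesis using up_r_prob False by (simp add: algebra_simps) (simp add: up_def algebra_simps)
qed

lemma um_l_prob:
  "um q i (ints v) * l_prob q i y v = q powi (ints v i - ints y (Suc i)) *
    (1 - q powi (ints y (Suc i) - ints v (Suc i)))"
proof -
  have le: "y (Suc i) \<le> v i" "v (Suc i) \<le> y (Suc i)" using vy i by (auto simp: interlace_def)
  show ?thesis
  proof (cases "v i = v (Suc i)")
    case True
    then show ?thesis using le by (simp add: um_def ints_def)
  next
    case neq: False
    then have "1 - q ^ (v i - v (Suc i)) \<noteq> 0"
      using le powi_eq_1_iff_real[OF q, of "int (v i - v (Suc i))"] by (simp add: power_int_of_nat del: of_nat_diff)
    then show ?thesis using le by (simp add: um_def ints_def l_prob_def powi_nat_diff)
  qed
qed

lemma um_not_l_prob: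
  "um q i (ints v) * (1 - l_prob q i y v) = 1 - q powi (ints v i - ints y (Suc i))"
proof -
  have "q powi (ints v i - ints y (Suc i)) * q powi (ints y (Suc i) - ints v (Suc i)) = q powi (ints v i - ints v (Suc i))"
    using q by (simp flip: power_int_add)
  then show ?thesis using um_l_prob by (simp add: algebra_simps) (simp add: um_def algebra_simps)
qed

end

text \<open>Passes from the coordinate that jumped to the one that receives the jump:
  \<open>R i\<close> stands for the rest of the process once coordinate \<open>i\<close> of the next
  level has received it, and \<open>b\<close> for a new letter, which always starts at coordinate
  1.\<close>

lemma regroup_right:
  fixes f g R :: "nat \<Rightarrow> real"
  shows "b * R 1 + (\<Sum>i=1..Suc l. f i * R i) + (\<Sum>i=1..l. g i * R (Suc i))
    = (\<Sum>i=1..Suc l. (f i + (if i = 1 then b else g (i - 1))) * R i)"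
  by (induction l) (simp_all add: algebra_simps)

text \<open>Without a letter there is no source term at coordinate 1, and the last handed-on jump
  stays unpaired; this is the origin of the extra term at odd levels.\<close>

lemma regroup_left:
  fixes f g R :: "nat \<Rightarrow> real"
  shows "(\<Sum>i=1..l. f i * R i) + (\<Sum>i=1..l. g i * R (Suc i))
    = (\<Sum>i=1..l. (f i + (if i = 1 then 0 else g (i - 1))) * R i) + (if l = 0 then 0 else g l) * R (Suc l)"
  by (induction l) (auto simp add: algebra_simps)

text \<open>
  In the following coefficients \<open>x\<close> is the new configuration of a level, whose old one is
  \<open>x \<mp> e\<^sub>i\<close>, and \<open>y\<close> is the old configuration of the next level; the jump is handed on to \<open>y\<^sub>i\<close>
  (\<open>same\<close>) or to \<open>y\<^sub>i\<^sub>+\<^sub>1\<close> (\<open>next\<close>). If \<open>x\<^sub>i = 0\<close>, the old configuration \<open>x - e\<^sub>i\<close> does not exist,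
  but then its weight, a function of integer tuples, vanishes.
\<close>

definition right_same :: "real \<Rightarrow> real \<Rightarrow> nat \<Rightarrow> (nat \<Rightarrow> int) \<Rightarrow> (nat \<Rightarrow> int) \<Rightarrow> nat \<Rightarrow> real" where
  "right_same b q L x y i = q powi (y i - x i + 1) * (if i = 1 then 1 else 1 - q powi (x (i - 1) - y i))
     * step_weight b q L (shift_at x i (-1)) y"

definition right_next_coeff :: "real \<Rightarrow> real \<Rightarrow> nat \<Rightarrow> (nat \<Rightarrow> int) \<Rightarrow> (nat \<Rightarrow> int) \<Rightarrow> nat \<Rightarrow> real" where
  "right_next_coeff b q L x y i = (1 - q powi (y i - x i + 1)) * step_weight b q L (shift_at x i (-1)) y"

definition left_same :: "real \<Rightarrow> real \<Rightarrow> nat \<Rightarrow> (nat \<Rightarrow> int) \<Rightarrow> (nat \<Rightarrow> int) \<Rightarrow> nat \<Rightarrow> real" where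
  "left_same b q L x y i = (1 - q powi (x i + 1 - y (Suc i))) * step_weight b q L (shift_at x i 1) y"

definition left_next_coeff :: "real \<Rightarrow> real \<Rightarrow> nat \<Rightarrow> (nat \<Rightarrow> int) \<Rightarrow> (nat \<Rightarrow> int) \<Rightarrow> nat \<Rightarrow> real" where
  "left_next_coeff b q L x y i = q powi (x i + 1 - y (Suc i)) * (1 - q powi (y (Suc i) - x (Suc i)))
     * step_weight b q L (shift_at x i 1) y"

context
  fixes b q :: real and l L :: nat and x y :: tuple
  assumes q: "0 < q" "q < 1" and lL: "l \<le> L" and x: "x \<in> Lam l" and y: "y \<in> Lam L"
begin

lemma sum_right_same:
  assumes "i \<in> {1..l}"
  shows "(\<Sum>v\<in>below l y. of_bool (x = incr v i) * (up q i (ints v) * r_prob q i y v)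
      * step_weight b q L (ints v) (ints y)) = right_same b q L (ints x) (ints y) i"
  unfolding right_same_def eq_incr_iff_ints
proof (rule sum_below_collapse[OF y lL])
  fix v assume v: "v \<in> below l y" "ints v = shift_at (ints x) i (-1)"
  have "up q i (ints v) * r_prob q i y v = q powi (ints y i - ints v i) *
    (if i = 1 then 1 else 1 - q powi (ints v (i - 1) - ints y i))"
    using v assms by (intro up_r_prob q) (auto simp: below_def)
  then show "up q i (ints v) * r_prob q i y v = q powi (ints y i - ints x i + 1) *
    (if i = 1 then 1 else 1 - q powi (ints x (i - 1) - ints y i))"
    using assms by (auto simp: v(2) algebra_simps)
qed (use x assms in \<open>auto simp: Lam_def shift_at_def ints_def\<close>)

lemma sum_right_next:
  assumes "i \<in> {1..l}"
  shows "(\<Sum>v\<in>below l y. of_bool (x = incr v i) * (up q i (ints v) * (1 - r_prob q i y v))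
      * step_weight b q L (ints v) (ints y)) = right_next_coeff b q L (ints x) (ints y) i"
  unfolding right_next_coeff_def eq_incr_iff_ints
proof (rule sum_below_collapse[OF y lL])
  fix v assume v: "v \<in> below l y" "ints v = shift_at (ints x) i (-1)"
  have "up q i (ints v) * (1 - r_prob q i y v) = 1 - q powi (ints y i - ints v i)"
    using v assms by (intro up_not_r_prob q) (auto simp: below_def)
  then show "up q i (ints v) * (1 - r_prob q i y v) = 1 - q powi (ints y i - ints x i + 1)"
    using assms by (auto simp: v(2) algebra_simps)
qed (use x assms in \<open>auto simp: Lam_def shift_at_def ints_def\<close>)

lemma sum_left_same:
  assumes "i \<in> {1..l}"
  shows "(\<Sum>v\<in>below l y. of_bool (v = incr x i) * (um q i (ints v) * (1 - l_prob q i y v))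
      * step_weight b q L (ints v) (ints y)) = left_same b q L (ints x) (ints y) i"
  unfolding left_same_def ints_inject[symmetric] ints_incr
proof (rule sum_below_collapse[OF y lL])
  fix v assume v: "v \<in> below l y" "ints v = shift_at (ints x) i 1"
  have "um q i (ints v) * (1 - l_prob q i y v) = 1 - q powi (ints v i - ints y (Suc i))"
    using v assms by (intro um_not_l_prob q) (auto simp: below_def)
  then show "um q i (ints v) * (1 - l_prob q i y v) = 1 - q powi (ints x i + 1 - ints y (Suc i))"
    using assms by (auto simp: v(2) algebra_simps)
qed (use x assms in \<open>auto simp: Lam_def shift_at_def ints_def\<close>)

lemma sum_left_next:
  assumes "i \<in> {1..l}"
  shows "(\<Sum>v\<in>below l y. of_bool (v = incr x i) * (um q i (ints v) * l_prob q i y v)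
      * step_weight b q L (ints v) (ints y)) = left_next_coeff b q L (ints x) (ints y) i"
  unfolding left_next_coeff_def ints_inject[symmetric] ints_incr
proof (rule sum_below_collapse[OF y lL])
  fix v assume v: "v \<in> below l y" "ints v = shift_at (ints x) i 1"
  have "um q i (ints v) * l_prob q i y v = q powi (ints v i - ints y (Suc i)) *
    (1 - q powi (ints y (Suc i) - ints v (Suc i)))"
    using v assms by (intro um_l_prob q) (auto simp: below_def)
  then show "um q i (ints v) * l_prob q i y v = q powi (ints x i + 1 - ints y (Suc i)) *
    (1 - q powi (ints y (Suc i) - ints x (Suc i)))"
    using assms by (auto simp: v(2) algebra_simps)
qed (use x assms in \<open>auto simp: Lam_def shift_at_def ints_def\<close>)

end

text \<open>The continuation \<open>R\<close> is a parameter: it will be \<open>right_prob\<close>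
  at the next level, which does not depend on the old configuration \<open>v\<close>, so the sum
  over \<open>v\<close> can be evaluated with \<open>R\<close> fixed.\<close>

definition moved_right :: "real \<Rightarrow> tuple \<Rightarrow> tuple \<Rightarrow> tuple \<Rightarrow> (nat \<Rightarrow> real) \<Rightarrow> nat \<Rightarrow> real" where
  "moved_right q x v y R i = of_bool (x = incr v i) *
     (r_prob q i y v * R i + (1 - r_prob q i y v) * R (Suc i))"

definition moved_left :: "real \<Rightarrow> tuple \<Rightarrow> tuple \<Rightarrow> tuple \<Rightarrow> (nat \<Rightarrow> real) \<Rightarrow> nat \<Rightarrow> real" where
  "moved_left q x v y X i = of_bool (v = incr x i) *
     (l_prob q i y v * X (Suc i) + (1 - l_prob q i y v) * X i)"

text \<open>The bound \<open>p\<close> separates the ordinary coordinates from the last one: for an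
  even level \<open>p\<close> is its full length, for an odd level it stops one short, because the
  last coordinate moves by a different rule.\<close>

lemma transition_sum:
  assumes q: "0 < q" "q < 1" and lL: "l \<le> L" and x: "x \<in> Lam l" and y: "y \<in> Lam L" and "p \<le> l"
  shows "(\<Sum>v\<in>below l y. (\<Sum>i=1..p. up q i (ints v) * moved_right q x v y R i + um q i (ints v) * moved_left q x v y X i)
      * step_weight b q L (ints v) (ints y))
   = (\<Sum>i=1..p. right_same b q L (ints x) (ints y) i * R i)
   + (\<Sum>i=1..p. right_next_coeff b q L (ints x) (ints y) i * R (Suc i))
   + ((\<Sum>i=1..p. left_same b q L (ints x) (ints y) i * X i)
   + (\<Sum>i=1..p. left_next_coeff b q L (ints x) (ints y) i * X (Suc i)))"
    (is "?L = ?R")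
proof -
  have "?L = (\<Sum>i=1..p. \<Sum>v\<in>below l y. (up q i (ints v) * moved_right q x v y R i + um q i (ints v) * moved_left q x v y X i)
      * step_weight b q L (ints v) (ints y))"
    unfolding sum_distrib_right by (rule sum.swap)
  also have "\<dots> = (\<Sum>i=1..p. right_same b q L (ints x) (ints y) i * R i
     + right_next_coeff b q L (ints x) (ints y) i * R (Suc i)
     + (left_same b q L (ints x) (ints y) i * X i + left_next_coeff b q L (ints x) (ints y) i * X (Suc i)))"
  proof (rule sum.cong)
    fix i assume "i \<in> {1..p}"
    then have i: "i \<in> {1..l}" using \<open>p \<le> l\<close> by auto
    show "(\<Sum>v\<in>below l y. (up q i (ints v) * moved_right q x v y R i + um q i (ints v) * moved_left q x v y X i)
      * step_weight b q L (ints v) (ints y)) = right_same b q L (ints x) (ints y) i * R i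
     + right_next_coeff b q L (ints x) (ints y) i * R (Suc i)
     + (left_same b q L (ints x) (ints y) i * X i + left_next_coeff b q L (ints x) (ints y) i * X (Suc i))"
      unfolding sum_right_same[OF q lL x y i, symmetric] sum_right_next[OF q lL x y i, symmetric]
        sum_left_same[OF q lL x y i, symmetric] sum_left_next[OF q lL x y i, symmetric]
        sum_distrib_right sum.distrib[symmetric]
      by (intro sum.cong) (auto simp: moved_right_def moved_left_def algebra_simps)
  qed simp
  finally show ?thesis by (simp add: sum.distrib)
qed

text \<open>On passing to an odd level the new coordinate has no predecessor in \<open>x\<close>;
  the formal term would have an old entry -1. Adding this zero term lets
  \<open>regroup_right\<close> run up to the new coordinate.\<close>

lemma right_same_outside:
  assumes "x \<in> Lam L" "y \<in> Lam (Suc L)" "Suc L \<le> K"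
  shows "right_same b q K (ints x) (ints y) (Suc L) = 0"
proof -
  have "x (Suc L) = 0" "y (Suc (Suc L)) = 0" using assms by (auto simp: Lam_def)
  then have "step_weight b q K (shift_at (ints x) (Suc L) (-1)) (ints y) = 0"
    using step_weight_nonzero(2)[of b q K "shift_at (ints x) (Suc L) (-1)" "ints y" "Suc L"] assms(3)
    by (auto simp: ints_def)
  then show ?thesis by (simp add: right_same_def)
qed

section \<open>Passage from an even to an odd level\<close>

context
  fixes b q :: real
  assumes b: "b > 0" and q: "0 < q" "q < 1"
begin

lemma right_coeff:
  assumes y: "y \<in> Lam L" and i: "i \<in> {1..L}"
  shows "right_same b q L x (ints y) i
      + (if i = 1 then b * step_weight b q L x (ints y) else right_next_coeff b q L x (ints y) (i - 1))
    = up q i (ints y) * step_weight b q L x (shift_at (ints y) i 1)"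
proof -
  have dec: "ints y (Suc j) \<le> ints y j" if "j \<ge> 1" for j
    using y that by (auto simp: Lam_def ints_def)
  show ?thesis
  proof (cases "i = 1")
    case True
    then show ?thesis using right_first[OF b q, of "ints y" L x] dec i
      by (simp add: right_same_def up_def)
  next
    case False
    then obtain j where j: "i = Suc j" "j \<ge> 1" using i by (cases i) auto
    then show ?thesis using right_next[OF b q, of "ints y" j L x] dec i
      by (simp add: right_same_def right_next_coeff_def up_def)
  qed
qed

lemma left_coeff:
  assumes y: "y \<in> Lam L" and i: "i \<in> {1..L}"
  shows "left_same b q L x (ints y) i
      + (if i = 1 then 0 else left_next_coeff b q L x (ints y) (i - 1))
    = um q i (ints y) * step_weight b q L x (shift_at (ints y) i (-1))"
proof -
  have dec: "ints y (Suc j) \<le> ints y j" if "j \<ge> 1" for j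
    using y that by (auto simp: Lam_def ints_def)
  show ?thesis
  proof (cases "i = 1")
    case True
    then show ?thesis using left_first[OF b q, of "ints y" L x] dec i
      by (simp add: left_same_def um_def numeral_2_eq_2)
  next
    case False
    then obtain j where j: "i = Suc j" "j \<ge> 1" using i by (cases i) auto
    then show ?thesis using left_next[OF b q, of "ints y" j L x] dec i
      by (simp add: left_same_def left_next_coeff_def um_def)
  qed
qed

text \<open>At the new coordinate \<open>Suc l\<close> the right identity is complete, since its
  missing term is 0 anyway. On the left only the jumps handed on from coordinate \<open>l\<close>
  exist; they do not add up to a multiple of \<open>um\<close> and survive as the last
  summand.\<close>

lemma even_level_transition:
  assumes x: "x \<in> Lam l" and y: "y \<in> Lam (Suc l)"
  shows "b * step_weight b q (Suc l) (ints x) (ints y) * R 1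
    + (\<Sum>v\<in>below l y. (\<Sum>i=1..l. up q i (ints v) * moved_right q x v y R i + um q i (ints v) * moved_left q x v y X i)
        * step_weight b q (Suc l) (ints v) (ints y))
    = (\<Sum>i=1..Suc l. up q i (ints y) * step_weight b q (Suc l) (ints x) (shift_at (ints y) i 1) * R i)
    + (\<Sum>i=1..l. um q i (ints y) * step_weight b q (Suc l) (ints x) (shift_at (ints y) i (-1)) * X i)
    + (if l = 0 then 0 else left_next_coeff b q (Suc l) (ints x) (ints y) l) * X (Suc l)"
proof -
  let ?sw = "step_weight b q (Suc l)"
  let ?rs = "right_same b q (Suc l) (ints x) (ints y)" and ?rn = "right_next_coeff b q (Suc l) (ints x) (ints y)"
  let ?ls = "left_same b q (Suc l) (ints x) (ints y)" and ?ln = "left_next_coeff b q (Suc l) (ints x) (ints y)"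
  have "b * ?sw (ints x) (ints y) * R 1 + ((\<Sum>i=1..l. ?rs i * R i) + (\<Sum>i=1..l. ?rn i * R (Suc i)))
    = b * ?sw (ints x) (ints y) * R 1 + (\<Sum>i=1..Suc l. ?rs i * R i) + (\<Sum>i=1..l. ?rn i * R (Suc i))"
    using right_same_outside[OF x y] by simp
  also have "\<dots> = (\<Sum>i=1..Suc l. (?rs i + (if i = 1 then b * ?sw (ints x) (ints y) else ?rn (i - 1))) * R i)"
    by (rule regroup_right)
  also have "\<dots> = (\<Sum>i=1..Suc l. up q i (ints y) * ?sw (ints x) (shift_at (ints y) i 1) * R i)"
    using right_coeff[OF y, of _ "ints x"] by (intro sum.cong) auto
  finally have r: "b * ?sw (ints x) (ints y) * R 1 + ((\<Sum>i=1..l. ?rs i * R i) + (\<Sum>i=1..l. ?rn i * R (Suc i)))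
    = (\<Sum>i=1..Suc l. up q i (ints y) * ?sw (ints x) (shift_at (ints y) i 1) * R i)" .
  have "(\<Sum>i=1..l. ?ls i * X i) + (\<Sum>i=1..l. ?ln i * X (Suc i))
    = (\<Sum>i=1..l. (?ls i + (if i = 1 then 0 else ?ln (i - 1))) * X i) + (if l = 0 then 0 else ?ln l) * X (Suc l)"
    by (rule regroup_left)
  also have "(\<Sum>i=1..l. (?ls i + (if i = 1 then 0 else ?ln (i - 1))) * X i)
    = (\<Sum>i=1..l. um q i (ints y) * ?sw (ints x) (shift_at (ints y) i (-1)) * X i)"
    using left_coeff[OF y, of _ "ints x"] by (intro sum.cong) auto
  finally have l: "(\<Sum>i=1..l. ?ls i * X i) + (\<Sum>i=1..l. ?ln i * X (Suc i))
    = (\<Sum>i=1..l. um q i (ints y) * ?sw (ints x) (shift_at (ints y) i (-1)) * X i)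
      + (if l = 0 then 0 else ?ln l) * X (Suc l)" .
  show ?thesis
    unfolding transition_sum[OF q le_SucI[OF order_refl] x y order_refl] l
    using r by (simp only: add.assoc[symmetric])
qed

end

section \<open>Passage from an odd to an even level\<close>

lemma qbin_diag: "0 < q \<Longrightarrow> q < 1 \<Longrightarrow> 0 \<le> N \<Longrightarrow> qbin q N N = 1"
  using q_poch_nonzero[of q "nat N"] by (simp add: qbin_def q_binom_def q_poch_def[of q 0])

text \<open>The three terms come from left jumps of the last two coordinates of the preceding odd level and
  from suppressed right jumps of its last coordinate. The latter two recombine by a \<open>q\<close>-Pascal rule
  for the weight of the odd level, unless \<open>x\<^sub>l = x\<^sub>m\<close>, when both vanish together with the
  corresponding part of the right-hand side.\<close>

lemma left_last:
  fixes x' x y :: "nat \<Rightarrow> int"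
  assumes b: "b > 0" and q: "0 < q" "q < 1" and l: "l \<ge> 1" and m: "m = Suc l"
    and x': "x' m = 0" and x: "x (Suc m) = 0" "0 \<le> x m" "x m \<le> x l"
    and y: "y (Suc m) = 0" "y m \<le> y l"
  shows "step_weight b q m x' x * left_next_coeff (inverse b) q m x y l
     + left_next_coeff b q m x' (shift_at x m 1) l * step_weight (inverse b) q m (shift_at x m 1) y
     + (1 - q powi (y m - x m)) * step_weight b q m x' (shift_at x m 1) * step_weight (inverse b) q m x y
     = step_weight b q m x' x * (um q m y * step_weight (inverse b) q m x (shift_at y m (-1)))"
proof -
  define c where "c = inverse b"
  have c: "c > 0" "b * c = 1" using b by (auto simp: c_def)
  define N where "N = x l - x m"
  define k where "k = x l - x' l"
  define B where "B = b powi x m"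
  define Q where "Q = (\<Prod>j\<in>{1..m}-{l,Suc l}. qw b q (x j - x (Suc j)) (x j - x' j))"
  define M where "M = y l - y m"
  define j where "j = y l - x l"
  define n where "n = y m"
  define p where "p = y m - x m"
  define T where "T = (\<Prod>j\<in>{1..m}-{l,Suc l}. qw c q (y j - y (Suc j)) (y j - x j))"
  \<comment> \<open>Since x'_m and x_(m+1) are 0, the last q-binomial of the odd level is trivial
    and only a power of \<open>b\<close> remains. Raising x_m by 1 costs a factor \<open>b\<close>,
    which in the suppressed term cancels against the \<open>c\<close> produced by absorption at the
    even level.\<close>
  have diag: "qw b q i i = b powi i" if "0 \<le> i" for i
    using qbin_diag[OF q that] by (simp add: qw_def)
  have B1: "b powi (x m + 1) = b * B" using b by (simp add: B_def power_int_add)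
  have s1: "step_weight b q m x' x = qw b q N k * B * Q"
    using l m x x' diag[of "x m"]
    by (subst step_weight_split_pair[of l m _ x' _ x]) (auto simp: N_def k_def B_def Q_def)
  have s2: "step_weight b q m (shift_at x' l 1) (shift_at x m 1) = qw b q (N - 1) (k - 1) * (b * B) * Q"
    using l m x x' diag[of "x m + 1"] B1
    by (subst step_weight_split_pair[of l m _ x' _ x]) (auto simp: N_def k_def Q_def algebra_simps)
  have s3: "step_weight b q m x' (shift_at x m 1) = qw b q (N - 1) k * (b * B) * Q"
    using l m x x' diag[of "x m + 1"] B1
    by (subst step_weight_split_pair[of l m _ x' _ x]) (auto simp: N_def k_def Q_def algebra_simps)
  have t1: "step_weight c q m (shift_at x l 1) y = qw c q M (j - 1) * qw c q n p * T"
    using l m y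
    by (subst step_weight_split_pair[of l m _ x _ y]) (auto simp: M_def j_def n_def p_def T_def algebra_simps)
  have t2: "step_weight c q m (shift_at x m 1) y = qw c q M j * qw c q n (p - 1) * T"
    using l m y
    by (subst step_weight_split_pair[of l m _ x _ y]) (auto simp: M_def j_def n_def p_def T_def algebra_simps)
  have t3: "step_weight c q m x y = qw c q M j * qw c q n p * T"
    using l m y
    by (subst step_weight_split_pair[of l m _ x _ y]) (auto simp: M_def j_def n_def p_def T_def algebra_simps)
  have t4: "step_weight c q m x (shift_at y m (-1)) = qw c q (M + 1) j * qw c q (n - 1) (p - 1) * T"
    using l m y
    by (subst step_weight_split_pair[of l m _ x _ y]) (auto simp: M_def j_def n_def p_def T_def algebra_simps)
  have e: "x l + 1 - y m = M - j + 1" "y m - x m = p" "x' l + 1 - (x m + 1) = N - k"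
    "x m + 1 - 0 = n - p + 1" "y m - 0 = n"
    by (simp_all add: M_def j_def N_def k_def n_def p_def)
  have r1: "(1 - q powi p) * qw c q n p = c * (1 - q powi n) * qw c q (n - 1) (p - 1)"
    by (rule qw_absorb[OF c(1) q])
  have r2: "(1 - q powi (n - p + 1)) * qw c q n (p - 1) = (1 - q powi n) * qw c q (n - 1) (p - 1)"
    using qw_absorb_comp[OF c(1) q, of n "p - 1"] by (simp add: algebra_simps)
  have "0 \<le> M" using y by (simp add: M_def)
  then have r3: "qw c q (M + 1) j = qw c q M j + c * q powi (M - j + 1) * qw c q M (j - 1)"
    by (rule qw_pascal'[OF c(1) q])
  have r4: "(qw b q (N - 1) k + b * q powi (N - k) * qw b q (N - 1) (k - 1)) * (qw c q M j * qw c q (n - 1) (p - 1))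
    = qw b q N k * (qw c q M j * qw c q (n - 1) (p - 1))"
  proof (cases "N = 0")
    case True
    have "qw c q M j * qw c q (n - 1) (p - 1) = 0"
    proof (rule ccontr)
      assume "\<not> ?thesis"
      then have "j \<le> M" "0 \<le> p - 1" using qw_eq_0 by (metis mult_eq_0_iff)+
      then show False using True by (simp add: M_def j_def p_def N_def)
    qed
    then show ?thesis by simp
  next
    case False
    then have "0 \<le> N - 1" using x by (simp add: N_def)
    then show ?thesis using qw_pascal'[OF b q, of "N - 1" k] by (simp add: algebra_simps)
  qed
  have "qw b q N k * B * Q * (q powi (M - j + 1) * (1 - q powi p) * (qw c q M (j - 1) * qw c q n p * T))
     + q powi (N - k) * (1 - q powi (n - p + 1)) * (qw b q (N - 1) (k - 1) * (b * B) * Q) * (qw c q M j * qw c q n (p - 1) * T)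
     + (1 - q powi p) * (qw b q (N - 1) k * (b * B) * Q) * (qw c q M j * qw c q n p * T)
     = qw b q N k * B * Q * ((1 - q powi n) * (qw c q (M + 1) j * qw c q (n - 1) (p - 1) * T))"
    (is "?A1 + ?A2 + ?A3 = ?A4")
  proof -
    have "?A1 = (1 - q powi n) * B * Q * T * qw c q (n - 1) (p - 1) * qw b q N k * (c * q powi (M - j + 1) * qw c q M (j - 1))"
      using r1 by algebra
    moreover have "?A2 = (1 - q powi n) * B * Q * T * (b * q powi (N - k) * qw b q (N - 1) (k - 1) * (qw c q M j * qw c q (n - 1) (p - 1)))"
      using r2 by algebra
    moreover have "?A3 = (1 - q powi n) * B * Q * T * (qw b q (N - 1) k * (qw c q M j * qw c q (n - 1) (p - 1)))"
      using r1 c(2) by algebra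
    moreover have "?A4 = (1 - q powi n) * B * Q * T * qw c q (n - 1) (p - 1) * qw b q N k * (qw c q M j + c * q powi (M - j + 1) * qw c q M (j - 1))"
      unfolding r3 by algebra
    ultimately show ?thesis using r4 by algebra
  qed
  then show ?thesis
    unfolding left_next_coeff_def um_def c_def[symmetric] m[symmetric] y(1) x' shift_at_simps(1)
      s1 s2 s3 t1 t2 t3 t4 e by (simp only: mult.assoc mult.left_commute mult.commute)
qed

text \<open>The counterpart of \<open>left_last\<close> for level 1, which no left jump can reach:
  all left jumps at level 2 come from suppressed right jumps.\<close>

lemma left_only:
  fixes x' x y :: "nat \<Rightarrow> int"
  assumes b: "b > 0" and q: "0 < q" "q < 1"
    and x': "x' 1 = 0" and x: "x 2 = 0" "0 \<le> x 1" and y: "y 2 = 0"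
  shows "(1 - q powi (y 1 - x 1)) * step_weight b q 1 x' (shift_at x 1 1) * step_weight (inverse b) q 1 x y
     = step_weight b q 1 x' x * (um q 1 y * step_weight (inverse b) q 1 x (shift_at y 1 (-1)))"
proof -
  define A where "A = qw b q (x 1) (x 1)"
  define U where "U = qw (inverse b) q (y 1) (y 1 - x 1)"
  define V where "V = qw (inverse b) q (y 1 - 1) (y 1 - x 1 - 1)"
  have "qw b q i i = b powi i" if "0 \<le> i" for i
    using qbin_diag[OF q that] by (simp add: qw_def)
  then have A: "qw b q (x 1 + 1) (x 1 + 1) = b * A"
    using x b by (simp add: A_def power_int_add)
  have "(1 - q powi (y 1 - x 1)) * U = inverse b * (1 - q powi (y 1)) * V"
    unfolding U_def V_def using b by (intro qw_absorb q) auto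
  moreover have "b * inverse b = 1" using b by simp
  moreover have "step_weight b q 1 x' (shift_at x 1 1) = b * A" "step_weight b q 1 x' x = A"
    "step_weight (inverse b) q 1 x y = U"
    using x x' y A by (simp_all add: step_weight_def numeral_2_eq_2 A_def U_def)
  moreover have "step_weight (inverse b) q 1 x (shift_at y 1 (-1)) = V"
    using y by (simp add: step_weight_def numeral_2_eq_2 V_def algebra_simps)
  moreover have "um q 1 y = 1 - q powi (y 1)" using y by (simp add: um_def numeral_2_eq_2)
  ultimately show ?thesis by algebra
qed

text \<open>Once a coordinate has moved, the shifted old level equals \<open>x\<close>, so the
  weight of the odd level becomes the constant \<open>?C\<close>. Two contributions resist: a
  suppressed jump, where the old level is \<open>x\<close> but the weight is taken at x + e_m, and
  the unpaired left jump of the last coordinate. Both feed only \<open>X m\<close>, and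
  \<open>left_last\<close> or \<open>left_only\<close> combines them with the regular left jumps
  into \<open>um\<close>.\<close>

lemma odd_level_transition:
  assumes b: "b > 0" and q: "0 < q" "q < 1" and m: "m = Suc l"
    and x': "x' \<in> Lam l" and x: "x \<in> Lam m" and y: "y \<in> Lam m"
  shows "(\<Sum>v\<in>below m y.
      ((\<Sum>i=1..l. up q i (ints v) * step_weight b q m (ints x') (shift_at (ints v) i 1) * moved_right q x v y R i
            + um q i (ints v) * step_weight b q m (ints x') (shift_at (ints v) i (-1)) * moved_left q x v y X i)
       + up q m (ints v) * step_weight b q m (ints x') (shift_at (ints v) m 1) *
           (of_bool (x = incr v m) * r_prob q m y v * R m + of_bool (x = v) * (1 - r_prob q m y v) * X m)
       + (if l = 0 then 0 else left_next_coeff b q m (ints x') (ints v) l) * moved_left q x v y X m)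
      * step_weight (inverse b) q m (ints v) (ints y))
    + step_weight b q m (ints x') (ints x) * (inverse b * step_weight (inverse b) q m (ints x) (ints y) * R 1)
    = step_weight b q m (ints x') (ints x) *
      (\<Sum>i=1..m. up q i (ints y) * step_weight (inverse b) q m (ints x) (shift_at (ints y) i 1) * R i
            + um q i (ints y) * step_weight (inverse b) q m (ints x) (shift_at (ints y) i (-1)) * X i)"
    (is "?S + ?C * (?c * ?cw (ints x) (ints y) * R 1) = _")
proof -
  let ?bw = "step_weight b q m"
  let ?rs = "right_same ?c q m (ints x) (ints y)" and ?rn = "right_next_coeff ?c q m (ints x) (ints y)"
  let ?ls = "left_same ?c q m (ints x) (ints y)" and ?ln = "left_next_coeff ?c q m (ints x) (ints y)"
  let ?T = "\<lambda>v. \<Sum>i=1..l. up q i (ints v) * moved_right q x v y R i + um q i (ints v) * moved_left q x v y X i"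
  let ?D = "\<lambda>v. if l = 0 then 0 else left_next_coeff b q m (ints x') v l"
  have c: "?c > 0" using b by simp
  have m1: "m \<in> {1..m}" and lm: "l \<le> m" using m by simp_all
  \<comment> \<open>Sorted by what happened at this level: a move of a coordinate up to
    \<open>l\<close>, a performed right jump of the last coordinate, a suppressed one, and a left
    jump of the last coordinate.\<close>
  have "?S = (\<Sum>v\<in>below m y. ?C * (?T v * ?cw (ints v) (ints y))
    + ?C * R m * (of_bool (x = incr v m) * (up q m (ints v) * r_prob q m y v) * ?cw (ints v) (ints y))
    + X m * (of_bool (ints v = ints x) * (up q m (ints v) * (1 - r_prob q m y v) * ?bw (ints x') (shift_at (ints v) m 1)) * ?cw (ints v) (ints y))
    + of_bool (ints v = shift_at (ints x) m 1) * (?D (ints v) * (l_prob q m y v * X (Suc m) + (1 - l_prob q m y v) * X m)) * ?cw (ints v) (ints y))"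
  proof (rule sum.cong)
    fix v
    have r: "?bw (ints x') (shift_at (ints v) i 1) * moved_right q x v y R i = ?C * moved_right q x v y R i" for i
      by (auto simp: moved_right_def ints_incr)
    have l: "?bw (ints x') (shift_at (ints v) i (-1)) * moved_left q x v y X i = ?C * moved_left q x v y X i" for i
    proof -
      have "v = incr x i \<Longrightarrow> shift_at (ints v) i (-1) = ints x" by (simp add: ints_incr shift_at_def)
      then show ?thesis by (auto simp: moved_left_def)
    qed
    have T: "(\<Sum>i=1..l. up q i (ints v) * ?bw (ints x') (shift_at (ints v) i 1) * moved_right q x v y R i
            + um q i (ints v) * ?bw (ints x') (shift_at (ints v) i (-1)) * moved_left q x v y X i) = ?C * ?T v"
      unfolding sum_distrib_left
    proof (intro sum.cong refl)
      fix i show "up q i (ints v) * ?bw (ints x') (shift_at (ints v) i 1) * moved_right q x v y R i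
            + um q i (ints v) * ?bw (ints x') (shift_at (ints v) i (-1)) * moved_left q x v y X i
        = ?C * (up q i (ints v) * moved_right q x v y R i + um q i (ints v) * moved_left q x v y X i)"
        using r[of i] l[of i] by algebra
    qed
    have last: "?bw (ints x') (shift_at (ints v) m 1) * of_bool (x = incr v m) = ?C * of_bool (x = incr v m)"
      by (auto simp: ints_incr)
    have stay: "of_bool (ints v = ints x) = (of_bool (x = v) :: real)" by (auto simp: ints_inject)
    show "((\<Sum>i=1..l. up q i (ints v) * ?bw (ints x') (shift_at (ints v) i 1) * moved_right q x v y R i
            + um q i (ints v) * ?bw (ints x') (shift_at (ints v) i (-1)) * moved_left q x v y X i)
       + up q m (ints v) * ?bw (ints x') (shift_at (ints v) m 1) *
           (of_bool (x = incr v m) * r_prob q m y v * R m + of_bool (x = v) * (1 - r_prob q m y v) * X m)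
       + (if l = 0 then 0 else left_next_coeff b q m (ints x') (ints v) l) * moved_left q x v y X m)
      * ?cw (ints v) (ints y)
      = ?C * (?T v * ?cw (ints v) (ints y))
    + ?C * R m * (of_bool (x = incr v m) * (up q m (ints v) * r_prob q m y v) * ?cw (ints v) (ints y))
    + X m * (of_bool (ints v = ints x) * (up q m (ints v) * (1 - r_prob q m y v) * ?bw (ints x') (shift_at (ints v) m 1)) * ?cw (ints v) (ints y))
    + of_bool (ints v = shift_at (ints x) m 1) * (?D (ints v) * (l_prob q m y v * X (Suc m) + (1 - l_prob q m y v) * X m)) * ?cw (ints v) (ints y)"
      unfolding T moved_left_def[of q x v y X m] ints_incr[of x m, symmetric] ints_inject[of v "incr x m"] stay
      using last by algebra
  qed simp
  also have "\<dots> = ?C * (\<Sum>v\<in>below m y. ?T v * ?cw (ints v) (ints y))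
    + ?C * R m * (\<Sum>v\<in>below m y. of_bool (x = incr v m) * (up q m (ints v) * r_prob q m y v) * ?cw (ints v) (ints y))
    + X m * (\<Sum>v\<in>below m y. of_bool (ints v = ints x) * (up q m (ints v) * (1 - r_prob q m y v) * ?bw (ints x') (shift_at (ints v) m 1)) * ?cw (ints v) (ints y))
    + (\<Sum>v\<in>below m y. of_bool (ints v = shift_at (ints x) m 1) * (?D (ints v) * (l_prob q m y v * X (Suc m) + (1 - l_prob q m y v) * X m)) * ?cw (ints v) (ints y))"
    unfolding sum_distrib_left sum.distrib ..
  also have "(\<Sum>v\<in>below m y. of_bool (ints v = ints x) * (up q m (ints v) * (1 - r_prob q m y v) * ?bw (ints x') (shift_at (ints v) m 1)) * ?cw (ints v) (ints y))
    = (1 - q powi (ints y m - ints x m)) * ?bw (ints x') (shift_at (ints x) m 1) * ?cw (ints x) (ints y)"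
  proof (rule sum_below_collapse[OF y order_refl])
    fix v assume v: "v \<in> below m y" "ints v = ints x"
    then show "up q m (ints v) * (1 - r_prob q m y v) * ?bw (ints x') (shift_at (ints v) m 1)
      = (1 - q powi (ints y m - ints x m)) * ?bw (ints x') (shift_at (ints x) m 1)"
      using up_not_r_prob[OF q, of m v y] m by (simp add: below_def)
  qed (use x in \<open>auto simp: Lam_def ints_def\<close>)
  also have "(\<Sum>v\<in>below m y. of_bool (ints v = shift_at (ints x) m 1) * (?D (ints v) * (l_prob q m y v * X (Suc m) + (1 - l_prob q m y v) * X m)) * ?cw (ints v) (ints y))
    = ?D (shift_at (ints x) m 1) * X m * ?cw (shift_at (ints x) m 1) (ints y)"
  proof (rule sum_below_collapse[OF y order_refl])
    fix v assume v: "v \<in> below m y" "ints v = shift_at (ints x) m 1"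
    \<comment> \<open>Both y_(m+1) and v_(m+1) are 0, so the numerator vanishes and the left jump
      stays at coordinate \<open>m\<close>.\<close>
    have "l_prob q m y v = 0" using v y by (simp add: below_def Lam_def l_prob_def)
    then show "?D (ints v) * (l_prob q m y v * X (Suc m) + (1 - l_prob q m y v) * X m)
      = ?D (shift_at (ints x) m 1) * X m" by (simp add: v(2))
  qed (use x m in \<open>auto simp: Lam_def ints_def shift_at_def\<close>)
  finally have S: "?S = ?C * ((\<Sum>i=1..l. ?rs i * R i) + (\<Sum>i=1..l. ?rn i * R (Suc i))
      + ((\<Sum>i=1..l. ?ls i * X i) + (\<Sum>i=1..l. ?ln i * X (Suc i)))) + ?C * R m * ?rs m
    + X m * ((1 - q powi (ints y m - ints x m)) * ?bw (ints x') (shift_at (ints x) m 1) * ?cw (ints x) (ints y))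
    + ?D (shift_at (ints x) m 1) * X m * ?cw (shift_at (ints x) m 1) (ints y)"
    by (simp only: transition_sum[OF q order_refl x y lm] sum_right_same[OF q order_refl x y m1])
  have "(?c * ?cw (ints x) (ints y)) * R 1 + (\<Sum>i=1..m. ?rs i * R i) + (\<Sum>i=1..l. ?rn i * R (Suc i))
    = (\<Sum>i=1..m. (?rs i + (if i = 1 then ?c * ?cw (ints x) (ints y) else ?rn (i - 1))) * R i)"
    unfolding m by (rule regroup_right)
  also have "\<dots> = (\<Sum>i=1..m. up q i (ints y) * ?cw (ints x) (shift_at (ints y) i 1) * R i)"
    using right_coeff[OF c q y, of _ "ints x"] by (intro sum.cong) auto
  finally have r: "(?c * ?cw (ints x) (ints y)) * R 1 + ((\<Sum>i=1..l. ?rs i * R i) + ?rs m * R m) + (\<Sum>i=1..l. ?rn i * R (Suc i))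
    = (\<Sum>i=1..m. up q i (ints y) * ?cw (ints x) (shift_at (ints y) i 1) * R i)" by (simp add: m)
  have "(\<Sum>i=1..l. ?ls i * X i) + (\<Sum>i=1..l. ?ln i * X (Suc i))
    = (\<Sum>i=1..l. (?ls i + (if i = 1 then 0 else ?ln (i - 1))) * X i) + (if l = 0 then 0 else ?ln l) * X (Suc l)"
    by (rule regroup_left)
  also have "(\<Sum>i=1..l. (?ls i + (if i = 1 then 0 else ?ln (i - 1))) * X i)
    = (\<Sum>i=1..l. um q i (ints y) * ?cw (ints x) (shift_at (ints y) i (-1)) * X i)"
    using left_coeff[OF c q y, of _ "ints x"] m by (intro sum.cong) auto
  finally have l: "(\<Sum>i=1..l. ?ls i * X i) + (\<Sum>i=1..l. ?ln i * X (Suc i))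
    = (\<Sum>i=1..l. um q i (ints y) * ?cw (ints x) (shift_at (ints y) i (-1)) * X i)
      + (if l = 0 then 0 else ?ln l) * X m" by (simp add: m)
  have last: "?C * (if l = 0 then 0 else ?ln l) + ?D (shift_at (ints x) m 1) * ?cw (shift_at (ints x) m 1) (ints y)
      + (1 - q powi (ints y m - ints x m)) * ?bw (ints x') (shift_at (ints x) m 1) * ?cw (ints x) (ints y)
    = ?C * (um q m (ints y) * ?cw (ints x) (shift_at (ints y) m (-1)))"
  proof -
    have z: "ints x' m = 0" "ints x (Suc m) = 0" "ints y (Suc m) = 0" "0 \<le> ints x m"
      using x' x y by (auto simp: m Lam_def ints_def)
    show ?thesis
    proof (cases "l = 0")
      case True
      then show ?thesis using left_only[OF b q, of "ints x'" "ints x" "ints y"] z m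
        by (simp add: numeral_2_eq_2)
    next
      case False
      have "ints x m \<le> ints x l" "ints y m \<le> ints y l" using x y m False by (auto simp: Lam_def ints_def)
      then show ?thesis using left_last[of b q l m "ints x'" "ints x" "ints y", OF b q _ m z(1,2,4) _ z(3)] False by simp
    qed
  qed
  have "?S + ?C * (?c * ?cw (ints x) (ints y) * R 1)
    = ?C * ((?c * ?cw (ints x) (ints y)) * R 1 + ((\<Sum>i=1..l. ?rs i * R i) + ?rs m * R m) + (\<Sum>i=1..l. ?rn i * R (Suc i)))
    + ?C * (\<Sum>i=1..l. um q i (ints y) * ?cw (ints x) (shift_at (ints y) i (-1)) * X i)
    + (?C * (if l = 0 then 0 else ?ln l) + ?D (shift_at (ints x) m 1) * ?cw (shift_at (ints x) m 1) (ints y)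
      + (1 - q powi (ints y m - ints x m)) * ?bw (ints x') (shift_at (ints x) m 1) * ?cw (ints x) (ints y)) * X m"
    unfolding S l by (simp only: algebra_simps)
  also have "\<dots> = ?C * ((\<Sum>i=1..m. up q i (ints y) * ?cw (ints x) (shift_at (ints y) i 1) * R i)
     + (\<Sum>i=1..m. um q i (ints y) * ?cw (ints x) (shift_at (ints y) i (-1)) * X i))"
    unfolding r last by (simp add: m algebra_simps)
  finally show ?thesis by (simp add: sum.distrib)
qed

section \<open>Insertion probabilities\<close>

text \<open>
  Since a move at level \<open>k\<close> is decided by the old configurations of the levels \<open>k\<close> and \<open>k + 1\<close>, the
  law of a jump is a product of one-level factors; the following functions are the part of that
  product contributed by the levels from \<open>k\<close> on.
\<close>

function left_prob :: "real \<Rightarrow> nat \<Rightarrow> nat \<Rightarrow> nat \<Rightarrow> pattern \<Rightarrow> pattern \<Rightarrow> real" where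
  "left_prob q n k i Z W =
     (if 2 * n \<le> k then of_bool (W k = (Z k)(i := Z k i - 1) \<and> (\<forall>j>k. W j = Z j))
      else of_bool (W k = (Z k)(i := Z k i - 1)) *
        (l_prob q i (Z (Suc k)) (Z k) * left_prob q n (Suc k) (Suc i) Z W
         + (1 - l_prob q i (Z (Suc k)) (Z k)) * left_prob q n (Suc k) i Z W))"
  by auto
termination by (relation "Wellfounded.measure (\<lambda>(q, n, k, i, Z, W). 2 * n - k)") auto

function right_prob :: "real \<Rightarrow> nat \<Rightarrow> nat \<Rightarrow> nat \<Rightarrow> pattern \<Rightarrow> pattern \<Rightarrow> real" where
  "right_prob q n k i Z W =
     (if 2 * n \<le> k then of_bool (W k = incr (Z k) i \<and> (\<forall>j>k. W j = Z j))
      else of_bool (W k = incr (Z k) i) * r_prob q i (Z (Suc k)) (Z k) * right_prob q n (Suc k) i Z W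
        + (1 - r_prob q i (Z (Suc k)) (Z k)) *
          (if odd k \<and> i = (k + 1) div 2 then of_bool (W k = Z k) * left_prob q n (Suc k) i Z W
           else of_bool (W k = incr (Z k) i) * right_prob q n (Suc k) (Suc i) Z W))"
  by auto
termination by (relation "Wellfounded.measure (\<lambda>(q, n, k, i, Z, W). 2 * n - k)") auto

declare left_prob.simps [simp del] right_prob.simps [simp del]

lemma left_prob_cong:
  "(\<And>j. k \<le> j \<Longrightarrow> Z j = Z' j) \<Longrightarrow> left_prob q n k i Z W = left_prob q n k i Z' W"
proof (induction "2 * n - k" arbitrary: k i rule: less_induct)
  case less
  show ?case
  proof (cases "2 * n \<le> k")
    case False
    then have "left_prob q n (Suc k) j Z W = left_prob q n (Suc k) j Z' W" for j
      using less.prems by (intro less.hyps) auto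
    then show ?thesis using False less.prems[of k] less.prems[of "Suc k"]
      by (simp add: left_prob.simps[of q n k])
  qed (use less.prems in \<open>simp add: left_prob.simps[of q n k]\<close>)
qed

lemma right_prob_cong:
  "(\<And>j. k \<le> j \<Longrightarrow> Z j = Z' j) \<Longrightarrow> right_prob q n k i Z W = right_prob q n k i Z' W"
proof (induction "2 * n - k" arbitrary: k i rule: less_induct)
  case less
  show ?case
  proof (cases "2 * n \<le> k")
    case False
    then have "right_prob q n (Suc k) j Z W = right_prob q n (Suc k) j Z' W" for j
      using less.prems by (intro less.hyps) auto
    moreover have "left_prob q n (Suc k) j Z W = left_prob q n (Suc k) j Z' W" for j
      using less.prems by (intro left_prob_cong) auto
    ultimately show ?thesis using False less.prems[of k] less.prems[of "Suc k"]
      by (simp add: right_prob.simps[of q n k])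
  qed (use less.prems in \<open>simp add: right_prob.simps[of q n k]\<close>)
qed

lemma pmf_bind_bernoulli:
  assumes "p \<in> {0..1}"
  shows "pmf (bind_pmf (bernoulli_pmf p) f) w = p * pmf (f True) w + (1 - p) * pmf (f False) w"
  using assms by (simp add: pmf_bind algebra_simps)

lemma agree_below_Suc_iff:
  "(\<forall>j<Suc k. W j = (Z(k := v)) j) \<longleftrightarrow> (\<forall>j<k. W j = Z j) \<and> W k = v"
  by (auto simp: less_Suc_eq)

text \<open>Interlacing keeps the Bernoulli parameters in [0,1]. It is assumed only from level
  \<open>k\<close> on: the recursive call sees a pattern whose levels \<open>k\<close> and
  \<open>k + 1\<close> may no longer interlace, but which agrees with \<open>Z\<close> from level
  \<open>Suc k\<close> on, where all later decisions are made.\<close>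

lemma pmf_left_jump:
  assumes q: "0 < q" "q < 1"
  shows "1 \<le> i \<Longrightarrow> \<forall>j\<in>{k..<2*n}. interlace (Z j) (Z (Suc j)) \<Longrightarrow>
    pmf (left_jump q n k i Z) W = of_bool (\<forall>j<k. W j = Z j) * left_prob q n k i Z W"
proof (induction "2 * n - k" arbitrary: k i Z rule: less_induct)
  case less
  show ?case
  proof (cases "2 * n \<le> k")
    case True
    have "move_left Z k i = W \<longleftrightarrow> (\<forall>j<k. W j = Z j) \<and> W k = (Z k)(i := Z k i - 1) \<and> (\<forall>j>k. W j = Z j)"
      unfolding move_left_def fun_eq_iff[of "Z(k := _)"]
      by (metis fun_upd_apply linorder_less_linear order_less_irrefl)
    then show ?thesis using True
      by (auto simp: left_jump.simps[of q n k] left_prob.simps[of q n k] indicator_def)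
  next
    case False
    have p: "l_prob q i (Z (Suc k)) (Z k) \<in> {0..1}"
      using less.prems False by (intro l_prob_in_unit q) auto
    have "pmf (left_jump q n (Suc k) j (move_left Z k i)) W
      = of_bool (\<forall>j<k. W j = Z j) * of_bool (W k = (Z k)(i := Z k i - 1)) * left_prob q n (Suc k) j Z W" if "j \<ge> 1" for j
    proof -
      have "pmf (left_jump q n (Suc k) j (move_left Z k i)) W
        = of_bool (\<forall>j<Suc k. W j = move_left Z k i j) * left_prob q n (Suc k) j (move_left Z k i) W"
        using less.prems False that by (intro less.hyps) (auto simp: move_left_def)
      moreover have "left_prob q n (Suc k) j (move_left Z k i) W = left_prob q n (Suc k) j Z W"
        by (intro left_prob_cong) (simp add: move_left_def)
      ultimately show ?thesis unfolding move_left_def agree_below_Suc_iff by simp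
    qed
    note * = this[of i] this[of "Suc i"]
    show ?thesis using False less.prems(1) *
      by (simp add: left_jump.simps[of q n k] left_prob.simps[of q n k i] pmf_bind_bernoulli[OF p] algebra_simps)
  qed
qed

lemma pmf_right_jump:
  assumes q: "0 < q" "q < 1"
  shows "1 \<le> i \<Longrightarrow> \<forall>j\<in>{k..<2*n}. interlace (Z j) (Z (Suc j)) \<Longrightarrow>
    pmf (right_jump q n k i Z) W = of_bool (\<forall>j<k. W j = Z j) * right_prob q n k i Z W"
proof (induction "2 * n - k" arbitrary: k i Z rule: less_induct)
  case less
  show ?case
  proof (cases "2 * n \<le> k")
    case True
    have "move_right Z k i = W \<longleftrightarrow> (\<forall>j<k. W j = Z j) \<and> W k = incr (Z k) i \<and> (\<forall>j>k. W j = Z j)"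
      unfolding move_right_def incr_def fun_eq_iff[of "Z(k := _)"]
      by (metis fun_upd_apply linorder_less_linear order_less_irrefl)
    then show ?thesis using True
      by (auto simp: right_jump.simps[of q n k] right_prob.simps[of q n k] indicator_def)
  next
    case False
    have p: "r_prob q i (Z (Suc k)) (Z k) \<in> {0..1}"
      using less.prems False by (intro r_prob_in_unit q) auto
    have r: "pmf (right_jump q n (Suc k) j (move_right Z k i)) W
      = of_bool (\<forall>j<k. W j = Z j) * of_bool (W k = incr (Z k) i) * right_prob q n (Suc k) j Z W" if "j \<ge> 1" for j
    proof -
      have "pmf (right_jump q n (Suc k) j (move_right Z k i)) W
        = of_bool (\<forall>j<Suc k. W j = move_right Z k i j) * right_prob q n (Suc k) j (move_right Z k i) W"
        using less.prems False that by (intro less.hyps) (auto simp: move_right_def)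
      moreover have "right_prob q n (Suc k) j (move_right Z k i) W = right_prob q n (Suc k) j Z W"
        by (intro right_prob_cong) (simp add: move_right_def)
      ultimately show ?thesis unfolding move_right_def agree_below_Suc_iff incr_def[symmetric] by simp
    qed
    have l: "pmf (left_jump q n (Suc k) i Z) W
      = of_bool (\<forall>j<k. W j = Z j) * of_bool (W k = Z k) * left_prob q n (Suc k) i Z W"
      using less.prems False pmf_left_jump[OF q, of i "Suc k" n Z W] agree_below_Suc_iff[of k W Z "Z k"] by auto
    define last where "last \<longleftrightarrow> odd k \<and> i = (k + 1) div 2"
    show ?thesis using False less.prems(1) r[of i] r[of "Suc i"] l
      by (simp add: right_jump.simps[of q n k i, folded last_def] right_prob.simps[of q n k i, folded last_def]
        pmf_bind_bernoulli[OF p] algebra_simps)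
  qed
qed

lemma right_prob_upd:
  assumes "k < 2 * n" "even k \<or> i \<noteq> (k + 1) div 2"
  shows "right_prob q n k i (Z(k := v)) W
    = moved_right q (W k) v (Z (Suc k)) (\<lambda>i. right_prob q n (Suc k) i Z W) i"
proof -
  have "right_prob q n (Suc k) j (Z(k := v)) W = right_prob q n (Suc k) j Z W" for j
    by (intro right_prob_cong) auto
  then show ?thesis using assms
    by (auto simp: right_prob.simps[of q n k] moved_right_def algebra_simps)
qed

lemma right_prob_upd_last:
  assumes "k < 2 * n" "odd k" "i = (k + 1) div 2"
  shows "right_prob q n k i (Z(k := v)) W
    = of_bool (W k = incr v i) * r_prob q i (Z (Suc k)) v * right_prob q n (Suc k) i Z W
      + of_bool (W k = v) * (1 - r_prob q i (Z (Suc k)) v) * left_prob q n (Suc k) i Z W"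
proof -
  have "right_prob q n (Suc k) j (Z(k := v)) W = right_prob q n (Suc k) j Z W"
    "left_prob q n (Suc k) j (Z(k := v)) W = left_prob q n (Suc k) j Z W" for j
    by (intro right_prob_cong left_prob_cong; auto)+
  then show ?thesis using assms
    by (auto simp: right_prob.simps[of q n k] algebra_simps)
qed

text \<open>The factor \<open>c\<close> takes care of the truncated subtraction in the case \<open>v i = 0\<close>.\<close>

lemma left_prob_upd:
  assumes "k < 2 * n" "v i = 0 \<Longrightarrow> c = 0"
  shows "c * left_prob q n k i (Z(k := v)) W
    = c * moved_left q (W k) v (Z (Suc k)) (\<lambda>i. left_prob q n (Suc k) i Z W) i"
proof (cases "v i = 0")
  case False
  have "left_prob q n (Suc k) j (Z(k := v)) W = left_prob q n (Suc k) j Z W" for j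
    by (intro left_prob_cong) auto
  moreover have "W k = v(i := v i - 1) \<longleftrightarrow> v = incr (W k) i"
    using False by (auto simp: incr_def fun_eq_iff)
  ultimately show ?thesis using assms
    by (simp add: left_prob.simps[of q n k] moved_left_def)
qed (use assms in simp)

text \<open>Hybrid patterns: the levels before \<open>k\<close> are already summed out and show the
  new pattern, the others are old. Interlacing across the seam is left to the step weight in
  \<open>letter_sum\<close>, so that the set can be peeled off level by level with
  \<open>below\<close>.\<close>

definition tails :: "nat \<Rightarrow> pattern \<Rightarrow> tuple \<Rightarrow> nat \<Rightarrow> pattern set" where
  "tails n W x k = {Z. (\<forall>j. j < k \<or> 2 * n < j \<longrightarrow> Z j = W j)
     \<and> (\<forall>j\<in>{k..2*n}. Z j \<in> Lam (level_length j))
     \<and> (\<forall>j\<in>{k..<2*n}. interlace (Z j) (Z (Suc j))) \<and> Z (2 * n) = x}"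

lemma tails_top:
  assumes "x \<in> Lam n"
  shows "tails n W x (2 * n) = {W(2 * n := x)}"
proof -
  have "Z = W(2 * n := x)" if "Z \<in> tails n W x (2 * n)" for Z
  proof
    fix j show "Z j = (W(2 * n := x)) j"
      using that by (cases j "2 * n" rule: linorder_cases) (auto simp: tails_def)
  qed
  moreover have "W(2 * n := x) \<in> tails n W x (2 * n)"
    using assms by (auto simp: tails_def level_length_def)
  ultimately show ?thesis by blast
qed

lemma bij_betw_tails:
  assumes "k < 2 * n"
  shows "bij_betw (\<lambda>(Z, v). Z(k := v))
    (SIGMA Z:tails n W x (Suc k). below (level_length k) (Z (Suc k))) (tails n W x k)"
proof -
  have up: "Z(k := v) \<in> tails n W x k" if Z: "Z \<in> tails n W x (Suc k)" and v: "v \<in> below (level_length k) (Z (Suc k))" for Z v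
    unfolding tails_def
  proof (intro CollectI conjI ballI allI impI)
    fix j assume "j \<in> {k..2*n}"
    then show "(Z(k := v)) j \<in> Lam (level_length j)"
      using Z v by (cases "j = k") (auto simp: tails_def below_def)
  next
    fix j assume "j \<in> {k..<2*n}"
    then show "interlace ((Z(k := v)) j) ((Z(k := v)) (Suc j))"
      using Z v by (cases "j = k") (auto simp: tails_def below_def)
  qed (use Z assms in \<open>auto simp: tails_def\<close>)
  have down: "Z(k := W k) \<in> tails n W x (Suc k)" if Z: "Z \<in> tails n W x k" for Z
    using Z assms by (simp add: tails_def less_Suc_eq)
  have mem: "Z k \<in> below (level_length k) (Z (Suc k))" if Z: "Z \<in> tails n W x k" for Z
    using Z assms by (simp add: tails_def below_def)
  have restore: "Z(k := W k) = Z" if "Z \<in> tails n W x (Suc k)" for Z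
    using that by (auto simp: tails_def)
  show ?thesis
    using up down mem restore by (intro bij_betw_byWitness[where f' = "\<lambda>Z. (Z(k := W k), Z k)"]) auto
qed

lemma finite_tails:
  assumes "x \<in> Lam n" "k \<le> 2 * n"
  shows "finite (tails n W x k)"
  using assms(2)
proof (induction rule: inc_induct)
  case base
  then show ?case by (simp add: tails_top assms)
next
  case (step k)
  then show ?case using bij_betw_finite[OF bij_betw_tails[of k n W x]] by (simp add: finite_below)
qed

lemma sum_tails:
  assumes "x \<in> Lam n" "k < 2 * n"
  shows "(\<Sum>Z\<in>tails n W x k. g Z)
    = (\<Sum>Z\<in>tails n W x (Suc k). \<Sum>v\<in>below (level_length k) (Z (Suc k)). g (Z(k := v)))"
proof -
  have "(\<Sum>Z\<in>tails n W x k. g Z)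
     = (\<Sum>(Z, v)\<in>(SIGMA Z:tails n W x (Suc k). below (level_length k) (Z (Suc k))). g (Z(k := v)))"
    using sum.reindex_bij_betw[OF bij_betw_tails[OF assms(2), of W x], of g] by (simp add: case_prod_unfold)
  also have "\<dots> = (\<Sum>Z\<in>tails n W x (Suc k). \<Sum>v\<in>below (level_length k) (Z (Suc k)). g (Z(k := v)))"
    using assms by (intro sum.Sigma[symmetric]) (auto intro: finite_tails finite_below)
  finally show ?thesis .
qed

section \<open>The intertwining relation\<close>

lemma KK_level: "Z \<in> KK n \<Longrightarrow> k \<le> 2 * n \<Longrightarrow> Z k \<in> Lam (level_length k)"
  by (cases "k = 0") (auto simp: KK_def Lam_def)

lemma tails_level: "Z \<in> tails n W x k \<Longrightarrow> k \<le> 2 * n \<Longrightarrow> Z k \<in> Lam (level_length k)"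
  by (simp add: tails_def)

text \<open>The weight of the letter of order \<open>k\<close>, used also as the base of the powers
  at level \<open>k\<close>.\<close>

definition beta :: "(nat \<Rightarrow> real) \<Rightarrow> nat \<Rightarrow> real" where
  "beta a k = (if odd k then a ((k + 1) div 2) else inverse (a (k div 2)))"

definition level_weight :: "real \<Rightarrow> (nat \<Rightarrow> real) \<Rightarrow> nat \<Rightarrow> pattern \<Rightarrow> real" where
  "level_weight q a k Z = step_weight (beta a k) q (level_length k) (ints (Z (k - 1))) (ints (Z k))"

text \<open>\<open>W\<close> is the pattern after the insertion, \<open>x\<close> the level 2n
  before it; the rest of the old pattern is summed over.\<close>

locale insertion_step =
  fixes q :: real and n :: nat and a :: "nat \<Rightarrow> real" and W :: pattern and x :: tuple
  assumes q: "0 < q" "q < 1" and a: "\<And>i. i \<in> {1..n} \<Longrightarrow> a i > 0"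
    and W: "W \<in> KK n" and x: "x \<in> Lam n"
begin

definition below_weight :: "nat \<Rightarrow> real" where
  "below_weight k = (\<Prod>j=1..k. level_weight q a j W)"

definition above_weight :: "nat \<Rightarrow> pattern \<Rightarrow> real" where
  "above_weight k Z = (\<Prod>j=Suc k..2*n. level_weight q a j Z)"

lemma above_weight_upd:
  assumes "k < 2 * n"
  shows "above_weight k (Z(k := v)) =
    step_weight (beta a (Suc k)) q (level_length (Suc k)) (ints v) (ints (Z (Suc k))) * above_weight (Suc k) Z"
proof -
  have "above_weight k (Z(k := v)) = level_weight q a (Suc k) (Z(k := v))
      * (\<Prod>j=Suc (Suc k)..2*n. level_weight q a j (Z(k := v)))"
    unfolding above_weight_def using assms by (intro prod.atLeast_Suc_atMost) simp
  also have "(\<Prod>j=Suc (Suc k)..2*n. level_weight q a j (Z(k := v))) = above_weight (Suc k) Z"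
    unfolding above_weight_def by (intro prod.cong) (auto simp: level_weight_def)
  also have "level_weight q a (Suc k) (Z(k := v))
      = step_weight (beta a (Suc k)) q (level_length (Suc k)) (ints v) (ints (Z (Suc k)))"
    by (simp add: level_weight_def)
  finally show ?thesis .
qed

text \<open>The contribution of the letter of order \<open>k\<close> without the weight of the
  levels before \<open>k\<close>, which the insertion leaves unchanged.\<close>

definition letter_sum :: "nat \<Rightarrow> real" where
  "letter_sum k = (\<Sum>Z\<in>tails n W x k. beta a k *
     step_weight (beta a k) q (level_length k) (ints (W (k - 1))) (ints (Z k)) * above_weight k Z * right_prob q n k 1 Z W)"

text \<open>Up to the factor \<open>below_weight (2 * l)\<close>, the joint contribution of all
  letters of order at most 2l, expressed through the jumps that arrive at level 2l.\<close>

definition even_sum :: "nat \<Rightarrow> real" where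
  "even_sum l = (\<Sum>Z\<in>tails n W x (2 * l). above_weight (2 * l) Z *
     (\<Sum>i=1..l. up q i (ints (Z (2 * l))) * right_prob q n (2 * l) i Z W
        + um q i (ints (Z (2 * l))) * left_prob q n (2 * l) i Z W))"

text \<open>Left jumps of the last coordinate of an odd level can only be handed on from the last coordinate
  of the level above, which leaves a coefficient that depends on that level.\<close>

definition odd_sum :: "nat \<Rightarrow> real" where
  "odd_sum l = (\<Sum>Z\<in>tails n W x (Suc (2 * l)). above_weight (Suc (2 * l)) Z *
     ((\<Sum>i=1..Suc l. up q i (ints (Z (Suc (2 * l)))) *
         step_weight (a (Suc l)) q (Suc l) (ints (W (2 * l))) (shift_at (ints (Z (Suc (2 * l)))) i 1) *
         right_prob q n (Suc (2 * l)) i Z W)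
      + (\<Sum>i=1..l. um q i (ints (Z (Suc (2 * l)))) *
         step_weight (a (Suc l)) q (Suc l) (ints (W (2 * l))) (shift_at (ints (Z (Suc (2 * l)))) i (-1)) *
         left_prob q n (Suc (2 * l)) i Z W)
      + (if l = 0 then 0 else left_next_coeff (a (Suc l)) q (Suc l) (ints (W (2 * l))) (ints (Z (Suc (2 * l)))) l) *
         left_prob q n (Suc (2 * l)) (Suc l) Z W))"

lemma levels [simp]:
  "level_length (2 * l) = l" "level_length (Suc (2 * l)) = Suc l" "level_length (Suc (Suc (2 * l))) = Suc l"
  "beta a (Suc (2 * l)) = a (Suc l)" "beta a (Suc (Suc (2 * l))) = inverse (a (Suc l))"
  by (simp_all add: level_length_def beta_def)

text \<open>An entry 0 carries no mass for a left jump, which supplies the side condition of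
  \<open>left_prob_upd\<close>.\<close>

lemma um_eq_0: "v \<in> Lam l \<Longrightarrow> i \<ge> 1 \<Longrightarrow> v i = 0 \<Longrightarrow> um q i (ints v) = 0"
  by (auto simp: Lam_def um_def ints_def)

lemma even_sum_step:
  assumes l: "l < n"
  shows "even_sum l + letter_sum (Suc (2 * l)) = odd_sum l"
proof -
  let ?k = "2 * l"
  let ?L = "\<lambda>Z i. left_prob q n (Suc ?k) i Z W" and ?R = "\<lambda>Z i. right_prob q n (Suc ?k) i Z W"
  let ?sw = "step_weight (a (Suc l)) q (Suc l)"
  have k: "?k < 2 * n" using l by simp
  have xk: "W ?k \<in> Lam l" using KK_level[OF W, of ?k] k by simp
  have aS: "a (Suc l) > 0" using a l by simp
  have "even_sum l = (\<Sum>Z\<in>tails n W x (Suc ?k). \<Sum>v\<in>below l (Z (Suc ?k)). above_weight (Suc ?k) Z *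
     ((\<Sum>i=1..l. up q i (ints v) * moved_right q (W ?k) v (Z (Suc ?k)) (?R Z) i
        + um q i (ints v) * moved_left q (W ?k) v (Z (Suc ?k)) (?L Z) i) * ?sw (ints v) (ints (Z (Suc ?k)))))"
    unfolding even_sum_def sum_tails[OF x k] levels
  proof (intro sum.cong refl)
    fix Z v assume v: "v \<in> below l (Z (Suc ?k))"
    have eq: "(\<Sum>i=1..l. up q i (ints ((Z(?k := v)) ?k)) * right_prob q n ?k i (Z(?k := v)) W
        + um q i (ints ((Z(?k := v)) ?k)) * left_prob q n ?k i (Z(?k := v)) W)
      = (\<Sum>i=1..l. up q i (ints v) * moved_right q (W ?k) v (Z (Suc ?k)) (?R Z) i
        + um q i (ints v) * moved_left q (W ?k) v (Z (Suc ?k)) (?L Z) i)"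
    proof (intro sum.cong refl)
      fix i assume i: "i \<in> {1..l}"
      have "um q i (ints v) * left_prob q n ?k i (Z(?k := v)) W
         = um q i (ints v) * moved_left q (W ?k) v (Z (Suc ?k)) (?L Z) i"
        using v i by (intro left_prob_upd k um_eq_0[of v l]) (auto simp: below_def)
      then show "up q i (ints ((Z(?k := v)) ?k)) * right_prob q n ?k i (Z(?k := v)) W
        + um q i (ints ((Z(?k := v)) ?k)) * left_prob q n ?k i (Z(?k := v)) W
        = up q i (ints v) * moved_right q (W ?k) v (Z (Suc ?k)) (?R Z) i
        + um q i (ints v) * moved_left q (W ?k) v (Z (Suc ?k)) (?L Z) i"
        by (simp add: right_prob_upd[OF k])
    qed
    show "above_weight ?k (Z(?k := v)) *
       (\<Sum>i=1..l. up q i (ints ((Z(?k := v)) ?k)) * right_prob q n ?k i (Z(?k := v)) W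
        + um q i (ints ((Z(?k := v)) ?k)) * left_prob q n ?k i (Z(?k := v)) W)
      = above_weight (Suc ?k) Z *
     ((\<Sum>i=1..l. up q i (ints v) * moved_right q (W ?k) v (Z (Suc ?k)) (?R Z) i
        + um q i (ints v) * moved_left q (W ?k) v (Z (Suc ?k)) (?L Z) i) * ?sw (ints v) (ints (Z (Suc ?k))))"
      unfolding eq above_weight_upd[OF k] levels by (simp only: mult_ac)
  qed
  then have "even_sum l + letter_sum (Suc ?k) = (\<Sum>Z\<in>tails n W x (Suc ?k). above_weight (Suc ?k) Z *
     (a (Suc l) * ?sw (ints (W ?k)) (ints (Z (Suc ?k))) * ?R Z 1
      + (\<Sum>v\<in>below l (Z (Suc ?k)). (\<Sum>i=1..l. up q i (ints v) * moved_right q (W ?k) v (Z (Suc ?k)) (?R Z) i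
        + um q i (ints v) * moved_left q (W ?k) v (Z (Suc ?k)) (?L Z) i) * ?sw (ints v) (ints (Z (Suc ?k))))))"
    unfolding letter_sum_def levels distrib_left sum.distrib sum_distrib_left
    by (simp add: algebra_simps)
  also have "\<dots> = odd_sum l"
    unfolding odd_sum_def
  proof (intro sum.cong refl)
    fix Z assume "Z \<in> tails n W x (Suc ?k)"
    from tails_level[OF this] have y: "Z (Suc ?k) \<in> Lam (Suc l)" using k by simp
    show "above_weight (Suc ?k) Z *
     (a (Suc l) * ?sw (ints (W ?k)) (ints (Z (Suc ?k))) * ?R Z 1
      + (\<Sum>v\<in>below l (Z (Suc ?k)). (\<Sum>i=1..l. up q i (ints v) * moved_right q (W ?k) v (Z (Suc ?k)) (?R Z) i
        + um q i (ints v) * moved_left q (W ?k) v (Z (Suc ?k)) (?L Z) i) * ?sw (ints v) (ints (Z (Suc ?k)))))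
    = above_weight (Suc ?k) Z *
     ((\<Sum>i=1..Suc l. up q i (ints (Z (Suc ?k))) * ?sw (ints (W ?k)) (shift_at (ints (Z (Suc ?k))) i 1) * ?R Z i)
      + (\<Sum>i=1..l. um q i (ints (Z (Suc ?k))) * ?sw (ints (W ?k)) (shift_at (ints (Z (Suc ?k))) i (-1)) * ?L Z i)
      + (if l = 0 then 0 else left_next_coeff (a (Suc l)) q (Suc l) (ints (W ?k)) (ints (Z (Suc ?k))) l) * ?L Z (Suc l))"
      unfolding even_level_transition[OF aS q xk y, where R = "?R Z" and X = "?L Z"] ..
  qed
  finally show ?thesis .
qed

text \<open>The weight of level 2l+1 multiplies the new letter because a letter of order 2l+2 leaves
  that level at its final value; for the other contributions \<open>odd_level_transition\<close>
  produces the same factor.\<close>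

lemma odd_sum_step:
  assumes l: "l < n"
  shows "odd_sum l + level_weight q a (Suc (2 * l)) W * letter_sum (Suc (Suc (2 * l)))
    = level_weight q a (Suc (2 * l)) W * level_weight q a (Suc (Suc (2 * l))) W * even_sum (Suc l)"
proof -
  let ?k = "Suc (2 * l)"
  let ?L = "\<lambda>Z i. left_prob q n (Suc ?k) i Z W" and ?R = "\<lambda>Z i. right_prob q n (Suc ?k) i Z W"
  let ?c = "inverse (a (Suc l))"
  let ?bw = "step_weight (a (Suc l)) q (Suc l)" and ?cw = "step_weight ?c q (Suc l)"
  let ?x' = "W (2 * l)" and ?x = "W ?k"
  let ?D = "\<lambda>v. if l = 0 then 0 else left_next_coeff (a (Suc l)) q (Suc l) (ints ?x') (ints v) l"
  let ?F = "\<lambda>Z v. (\<Sum>i=1..l. up q i (ints v) * ?bw (ints ?x') (shift_at (ints v) i 1) * moved_right q ?x v (Z (Suc ?k)) (?R Z) i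
            + um q i (ints v) * ?bw (ints ?x') (shift_at (ints v) i (-1)) * moved_left q ?x v (Z (Suc ?k)) (?L Z) i)
       + up q (Suc l) (ints v) * ?bw (ints ?x') (shift_at (ints v) (Suc l) 1) *
           (of_bool (?x = incr v (Suc l)) * r_prob q (Suc l) (Z (Suc ?k)) v * ?R Z (Suc l)
            + of_bool (?x = v) * (1 - r_prob q (Suc l) (Z (Suc ?k)) v) * ?L Z (Suc l))
       + ?D v * moved_left q ?x v (Z (Suc ?k)) (?L Z) (Suc l)"
  let ?G = "\<lambda>y i. up q i (ints y) * ?cw (ints ?x) (shift_at (ints y) i 1)"
  let ?H = "\<lambda>y i. um q i (ints y) * ?cw (ints ?x) (shift_at (ints y) i (-1))"
  have k: "?k < 2 * n" using l by simp
  have x': "?x' \<in> Lam l" using KK_level[OF W, of "2 * l"] l by simp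
  have xk: "?x \<in> Lam (Suc l)" using KK_level[OF W, of ?k] k by simp
  have aS: "a (Suc l) > 0" using a l by simp
  have lw: "level_weight q a ?k W = ?bw (ints ?x') (ints ?x)" by (simp add: level_weight_def)
  have "odd_sum l = (\<Sum>Z\<in>tails n W x (Suc ?k). \<Sum>v\<in>below (Suc l) (Z (Suc ?k)). above_weight (Suc ?k) Z *
     (?F Z v * ?cw (ints v) (ints (Z (Suc ?k)))))"
    unfolding odd_sum_def sum_tails[OF x k] levels fun_upd_same
  proof (intro sum.cong refl)
    fix Z v assume v: "v \<in> below (Suc l) (Z (Suc ?k))"
    have vL: "v \<in> Lam (Suc l)" using v by (simp add: below_def)
    have L: "um q i (ints v) * ?bw (ints ?x') (shift_at (ints v) i (-1)) * left_prob q n ?k i (Z(?k := v)) W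
       = um q i (ints v) * ?bw (ints ?x') (shift_at (ints v) i (-1)) * moved_left q ?x v (Z (Suc ?k)) (?L Z) i" if "i \<ge> 1" for i
      using um_eq_0[OF vL that] by (intro left_prob_upd k) auto
    have D: "?D v * left_prob q n ?k (Suc l) (Z(?k := v)) W
       = ?D v * moved_left q ?x v (Z (Suc ?k)) (?L Z) (Suc l)"
    proof (intro left_prob_upd k)
      \<comment> \<open>The coefficient contains 1 - q^(v_(l+1) - x'_(l+1)), which is 0 when both
        entries are 0; hence no left jump starts from an entry 0 here either.\<close>
      have "?x' (Suc l) = 0" using x' by (simp add: Lam_def)
      then show "?D v = 0" if "v (Suc l) = 0" using that by (simp add: left_next_coeff_def ints_def)
    qed
    have R: "right_prob q n ?k i (Z(?k := v)) W = moved_right q ?x v (Z (Suc ?k)) (?R Z) i" if "i \<le> l" for i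
      using that by (intro right_prob_upd k) auto
    have R': "right_prob q n ?k (Suc l) (Z(?k := v)) W
       = of_bool (?x = incr v (Suc l)) * r_prob q (Suc l) (Z (Suc ?k)) v * ?R Z (Suc l)
            + of_bool (?x = v) * (1 - r_prob q (Suc l) (Z (Suc ?k)) v) * ?L Z (Suc l)"
      by (intro right_prob_upd_last k) auto
    have L_sum: "(\<Sum>i=1..l. um q i (ints v) * ?bw (ints ?x') (shift_at (ints v) i (-1)) * left_prob q n ?k i (Z(?k := v)) W)
      = (\<Sum>i=1..l. um q i (ints v) * ?bw (ints ?x') (shift_at (ints v) i (-1)) * moved_left q ?x v (Z (Suc ?k)) (?L Z) i)"
      using L by (intro sum.cong) auto
    have R_sum: "(\<Sum>i=1..l. up q i (ints v) * ?bw (ints ?x') (shift_at (ints v) i 1) * right_prob q n ?k i (Z(?k := v)) W)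
      = (\<Sum>i=1..l. up q i (ints v) * ?bw (ints ?x') (shift_at (ints v) i 1) * moved_right q ?x v (Z (Suc ?k)) (?R Z) i)"
      using R by (intro sum.cong) auto
    have split: "(\<Sum>i=1..Suc l. g i) = (\<Sum>i=1..l. g i) + g (Suc l)" for g :: "nat \<Rightarrow> real" by simp
    have eq: "(\<Sum>i=1..Suc l. up q i (ints v) * ?bw (ints ?x') (shift_at (ints v) i 1) * right_prob q n ?k i (Z(?k := v)) W)
      + (\<Sum>i=1..l. um q i (ints v) * ?bw (ints ?x') (shift_at (ints v) i (-1)) * left_prob q n ?k i (Z(?k := v)) W)
      + ?D v * left_prob q n ?k (Suc l) (Z(?k := v)) W = ?F Z v"
      unfolding split L_sum R_sum D R' sum.distrib by (simp only: add_ac)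
    show "above_weight ?k (Z(?k := v)) * ((\<Sum>i=1..Suc l. up q i (ints v) * ?bw (ints ?x') (shift_at (ints v) i 1) * right_prob q n ?k i (Z(?k := v)) W)
      + (\<Sum>i=1..l. um q i (ints v) * ?bw (ints ?x') (shift_at (ints v) i (-1)) * left_prob q n ?k i (Z(?k := v)) W)
      + ?D v * left_prob q n ?k (Suc l) (Z(?k := v)) W)
      = above_weight (Suc ?k) Z * (?F Z v * ?cw (ints v) (ints (Z (Suc ?k))))"
      unfolding eq above_weight_upd[OF k] levels by (simp only: mult_ac)
  qed
  then have "odd_sum l + level_weight q a ?k W * letter_sum (Suc ?k) = (\<Sum>Z\<in>tails n W x (Suc ?k). above_weight (Suc ?k) Z *
     ((\<Sum>v\<in>below (Suc l) (Z (Suc ?k)). ?F Z v * ?cw (ints v) (ints (Z (Suc ?k))))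
       + ?bw (ints ?x') (ints ?x) * (?c * ?cw (ints ?x) (ints (Z (Suc ?k))) * ?R Z 1)))"
    unfolding letter_sum_def levels lw distrib_left[of "above_weight _ _"] sum.distrib sum_distrib_left
    by (simp add: mult_ac)
  also have "\<dots> = (\<Sum>Z\<in>tails n W x (Suc ?k). ?bw (ints ?x') (ints ?x) * ?cw (ints ?x) (ints (W (Suc ?k))) *
     (above_weight (Suc ?k) Z * (\<Sum>i=1..Suc l. up q i (ints (Z (Suc ?k))) * ?R Z i + um q i (ints (Z (Suc ?k))) * ?L Z i)))"
  proof (intro sum.cong refl)
    fix Z assume "Z \<in> tails n W x (Suc ?k)"
    from tails_level[OF this] have y: "Z (Suc ?k) \<in> Lam (Suc l)" using k by simp
    have eq: "(\<Sum>i=1..Suc l. ?G (Z (Suc ?k)) i * ?R Z i + ?H (Z (Suc ?k)) i * ?L Z i)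
      = ?cw (ints ?x) (ints (W (Suc ?k))) * (\<Sum>i=1..Suc l. up q i (ints (Z (Suc ?k))) * ?R Z i + um q i (ints (Z (Suc ?k))) * ?L Z i)"
      unfolding sum_distrib_left
    proof (intro sum.cong refl)
      fix i assume i: "i \<in> {1..Suc l}"
      \<comment> \<open>Level \<open>Suc ?k\<close> is even, where an attempted right jump is always
        performed. The continuation therefore vanishes unless the shifted old level is the new one,
        and the weight may be taken at \<open>W\<close>.\<close>
      have "?cw (ints ?x) (shift_at (ints (Z (Suc ?k))) i 1) * ?R Z i = ?cw (ints ?x) (ints (W (Suc ?k))) * ?R Z i"
        by (auto simp: right_prob.simps[of q n "Suc ?k"] ints_incr)
      moreover have "?H (Z (Suc ?k)) i * ?L Z i = um q i (ints (Z (Suc ?k))) * ?cw (ints ?x) (ints (W (Suc ?k))) * ?L Z i"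
      proof (cases "?L Z i = 0 \<or> Z (Suc ?k) i = 0")
        case True
        then show ?thesis using um_eq_0[OF y, of i] i by auto
      next
        case False
        then have "W (Suc ?k) = (Z (Suc ?k))(i := Z (Suc ?k) i - 1)"
          by (auto simp: left_prob.simps[of q n "Suc ?k"] split: if_splits)
        then have "ints (W (Suc ?k)) = shift_at (ints (Z (Suc ?k))) i (-1)"
          using False by (auto simp: ints_def shift_at_def fun_eq_iff)
        then show ?thesis by simp
      qed
      ultimately show "?G (Z (Suc ?k)) i * ?R Z i + ?H (Z (Suc ?k)) i * ?L Z i
        = ?cw (ints ?x) (ints (W (Suc ?k))) * (up q i (ints (Z (Suc ?k))) * ?R Z i + um q i (ints (Z (Suc ?k))) * ?L Z i)"
        by algebra
    qed
    show "above_weight (Suc ?k) Z *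
     ((\<Sum>v\<in>below (Suc l) (Z (Suc ?k)). ?F Z v * ?cw (ints v) (ints (Z (Suc ?k))))
       + ?bw (ints ?x') (ints ?x) * (?c * ?cw (ints ?x) (ints (Z (Suc ?k))) * ?R Z 1))
     = ?bw (ints ?x') (ints ?x) * ?cw (ints ?x) (ints (W (Suc ?k))) *
     (above_weight (Suc ?k) Z * (\<Sum>i=1..Suc l. up q i (ints (Z (Suc ?k))) * ?R Z i + um q i (ints (Z (Suc ?k))) * ?L Z i))"
      unfolding odd_level_transition[OF aS q refl x' xk y, where R = "?R Z" and X = "?L Z"] eq
      by (simp only: mult_ac)
  qed
  also have "\<dots> = level_weight q a ?k W * level_weight q a (Suc ?k) W * even_sum (Suc l)"
    unfolding sum_distrib_left[symmetric] even_sum_def by (simp add: level_weight_def)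
  finally show ?thesis .
qed

text \<open>Each step adds the letters of orders 2l+1 and 2l+2 and passes through the two
  corresponding levels; \<open>odd_sum\<close> occurs only in between.\<close>

lemma letter_sums:
  "l \<le> n \<Longrightarrow> (\<Sum>k=1..2*l. below_weight (k - 1) * letter_sum k) = below_weight (2 * l) * even_sum l"
proof (induction l)
  case 0
  then show ?case by (simp add: even_sum_def)
next
  case (Suc l)
  then have l: "l < n" by simp
  have b: "below_weight (Suc k) = below_weight k * level_weight q a (Suc k) W" for k
    by (simp add: below_weight_def)
  have "(\<Sum>k=1..2*Suc l. below_weight (k - 1) * letter_sum k)
    = below_weight (2 * l) * (even_sum l + letter_sum (Suc (2 * l)) + level_weight q a (Suc (2 * l)) W * letter_sum (Suc (Suc (2 * l))))"
    using Suc by (simp add: b algebra_simps)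
  also have "\<dots> = below_weight (2 * Suc l) * even_sum (Suc l)"
    unfolding even_sum_step[OF l] odd_sum_step[OF l] by (simp add: b)
  finally show ?case .
qed

text \<open>At level 2n no sum and no weight remain: the jump must turn \<open>x\<close> into
  \<open>W (2 * n)\<close>, which leaves exactly the rates of \<open>L_kernel\<close>.\<close>

lemma even_sum_top: "even_sum n = L_kernel q n x (W (2 * n))"
proof -
  have "W (2 * n) = x(i := x i - 1) \<longleftrightarrow> x = incr (W (2 * n)) i" if "x i \<noteq> 0" for i
    using that by (auto simp: incr_def fun_eq_iff)
  then have um: "um q i (ints x) * of_bool (W (2 * n) = x(i := x i - 1))
     = um q i (ints x) * of_bool (x = incr (W (2 * n)) i)" if "i \<ge> 1" for i
    using um_eq_0[OF x that] by (cases "x i = 0") auto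
  have "even_sum n = (\<Sum>i=1..n. up q i (ints x) * of_bool (W (2 * n) = incr x i)
      + um q i (ints x) * of_bool (W (2 * n) = x(i := x i - 1)))"
    by (simp add: even_sum_def tails_top[OF x] above_weight_def right_prob.simps[of q n "2 * n"]
      left_prob.simps[of q n "2 * n"])
  also have "\<dots> = L_kernel q n x (W (2 * n))"
    unfolding L_kernel_def
  proof (intro sum.cong refl)
    fix i assume i: "i \<in> {1..n}"
    then have "i \<ge> 1" by simp
    then show "up q i (ints x) * of_bool (W (2 * n) = incr x i)
      + um q i (ints x) * of_bool (W (2 * n) = x(i := x i - 1))
      = (if W (2 * n) = incr x i then u_plus q n i x else 0) + (if x = incr (W (2 * n)) i then u_minus q n i x else 0)"
      unfolding um[OF \<open>i \<ge> 1\<close>] u_plus_eq_up[OF x \<open>i \<ge> 1\<close>] u_minus_eq_um[OF x i] by simp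
  qed
  finally show ?thesis .
qed

text \<open>An insertion at level \<open>k\<close> forces the old pattern to agree with
  \<open>W\<close> before \<open>k\<close>. Such patterns form the part of
  \<open>tails n W x k\<close> that interlaces across levels \<open>k - 1\<close> and
  \<open>k\<close>; on the rest the step weight is 0, so the sum may run over all of
  \<open>tails\<close>.\<close>

lemma insertion_letter_sum:
  assumes k: "k \<in> {1..2*n}"
  shows "(\<Sum>Z\<in>{Z\<in>KK n. Z (2 * n) = x}. (\<Prod>j=1..2*n. level_weight q a j Z) * (beta a k * pmf (right_jump q n k 1 Z) W))
    = below_weight (k - 1) * letter_sum k"
proof -
  let ?T = "{Z \<in> KK n. Z (2 * n) = x \<and> (\<forall>j<k. Z j = W j)}"
  have split: "(\<Prod>j=1..2*n. level_weight q a j Z) = below_weight (k - 1) *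
      step_weight (beta a k) q (level_length k) (ints (W (k - 1))) (ints (Z k)) * above_weight k Z"
    if "\<forall>j<k. Z j = W j" for Z
  proof -
    have ins: "prod f (insert k (A \<union> B)) = f k * (prod f A * prod f B)"
      if "finite A" "finite B" "k \<notin> A \<union> B" "A \<inter> B = {}" for A B and f :: "nat \<Rightarrow> real"
      using that by (simp add: prod.union_disjoint)
    have "{1..2*n} = insert k ({1..k-1} \<union> {Suc k..2*n})" using k by auto
    moreover have "(\<Prod>j\<in>insert k ({1..k-1} \<union> {Suc k..2*n}). level_weight q a j Z)
        = level_weight q a k Z * ((\<Prod>j=1..k-1. level_weight q a j Z) * above_weight k Z)"
      unfolding above_weight_def using k by (intro ins) auto
    ultimately have "(\<Prod>j=1..2*n. level_weight q a j Z) = (\<Prod>j=1..k-1. level_weight q a j Z) * level_weight q a k Z * above_weight k Z"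
      by simp
    moreover have "(\<Prod>j=1..k-1. level_weight q a j Z) = below_weight (k - 1)"
      unfolding below_weight_def using that k by (intro prod.cong) (auto simp: level_weight_def)
    moreover have "Z (k - 1) = W (k - 1)" using that k by simp
    ultimately show ?thesis by (simp add: level_weight_def)
  qed
  have "(\<Sum>Z\<in>{Z\<in>KK n. Z (2 * n) = x}. (\<Prod>j=1..2*n. level_weight q a j Z) * (beta a k * pmf (right_jump q n k 1 Z) W))
    = (\<Sum>Z\<in>{Z\<in>KK n. Z (2 * n) = x}. if \<forall>j<k. Z j = W j then below_weight (k - 1) * (beta a k *
     step_weight (beta a k) q (level_length k) (ints (W (k - 1))) (ints (Z k)) * above_weight k Z * right_prob q n k 1 Z W) else 0)"
  proof (intro sum.cong refl)
    fix Z assume "Z \<in> {Z\<in>KK n. Z (2 * n) = x}"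
    then have "\<forall>j\<in>{k..<2*n}. interlace (Z j) (Z (Suc j))" using k by (auto simp: KK_def)
    then have "pmf (right_jump q n k 1 Z) W = of_bool (\<forall>j<k. Z j = W j) * right_prob q n k 1 Z W"
      using pmf_right_jump[OF q, of 1 k n Z W] by (simp add: eq_commute)
    then show "(\<Prod>j=1..2*n. level_weight q a j Z) * (beta a k * pmf (right_jump q n k 1 Z) W)
      = (if \<forall>j<k. Z j = W j then below_weight (k - 1) * (beta a k *
     step_weight (beta a k) q (level_length k) (ints (W (k - 1))) (ints (Z k)) * above_weight k Z * right_prob q n k 1 Z W) else 0)"
      using split[of Z] by simp
  qed
  also have "\<dots> = (\<Sum>Z\<in>?T. below_weight (k - 1) * (beta a k *
     step_weight (beta a k) q (level_length k) (ints (W (k - 1))) (ints (Z k)) * above_weight k Z * right_prob q n k 1 Z W))"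
    by (subst sum.inter_filter[symmetric, OF finite_KK_top]) (auto intro!: sum.cong)
  also have "\<dots> = (\<Sum>Z\<in>tails n W x k. below_weight (k - 1) * (beta a k *
     step_weight (beta a k) q (level_length k) (ints (W (k - 1))) (ints (Z k)) * above_weight k Z * right_prob q n k 1 Z W))"
  proof (rule sum.mono_neutral_left)
    show "finite (tails n W x k)" using k by (intro finite_tails x) auto
    show "?T \<subseteq> tails n W x k" using W k by (auto simp: tails_def KK_def)
    show "\<forall>Z\<in>tails n W x k - ?T. below_weight (k - 1) * (beta a k *
     step_weight (beta a k) q (level_length k) (ints (W (k - 1))) (ints (Z k)) * above_weight k Z * right_prob q n k 1 Z W) = 0"
    proof
      fix Z assume Z: "Z \<in> tails n W x k - ?T"
      have "step_weight (beta a k) q (level_length k) (ints (W (k - 1))) (ints (Z k)) = 0"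
      proof (rule ccontr)
        assume nz: "\<not> ?thesis"
        have Wl: "W (k - 1) \<in> Lam (level_length (k - 1))" using k by (intro KK_level[OF W]) auto
        have Zl: "Z k \<in> Lam (level_length k)" using Z k tails_level[of Z n W x k] by simp
        have le: "level_length (k - 1) \<le> level_length k" by (simp add: level_length_def div_le_mono)
        have il: "interlace (W (k - 1)) (Z k)"
          unfolding interlace_def
        proof (intro allI impI)
          fix i :: nat assume "i \<ge> 1"
          then show "W (k - 1) i \<le> Z k i \<and> Z k (Suc i) \<le> W (k - 1) i"
            using step_weight_nonzero[OF nz, of i] Wl Zl le
            by (cases "i \<le> level_length k") (auto simp: ints_def Lam_def)
        qed
        have "Z \<in> KK n"
          unfolding KK_def
        proof (intro CollectI conjI ballI allI impI)
          fix j assume "j \<in> {1..2*n}"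
          then show "Z j \<in> Lam (level_length j)"
            using Z KK_level[OF W, of j] by (cases "j < k") (auto simp: tails_def)
        next
          fix j assume "j \<notin> {1..2*n}"
          then show "Z j = (\<lambda>i. 0)" using Z W k by (cases "j = 0") (auto simp: tails_def KK_def)
        next
          fix j assume j: "j \<in> {1..<2*n}"
          consider "Suc j < k" | "Suc j = k" | "k \<le> j" by linarith
          then show "interlace (Z j) (Z (Suc j))"
          proof cases
            case 1
            then show ?thesis using Z W j by (auto simp: tails_def KK_def)
          next
            case 2
            then show ?thesis using Z il by (auto simp: tails_def)
          next
            case 3
            then show ?thesis using Z j by (auto simp: tails_def)
          qed
        qed
        then show False using Z by (auto simp: tails_def)
      qed
      then show "below_weight (k - 1) * (beta a k *
     step_weight (beta a k) q (level_length k) (ints (W (k - 1))) (ints (Z k)) * above_weight k Z * right_prob q n k 1 Z W) = 0"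
        by simp
    qed
  qed
  also have "\<dots> = below_weight (k - 1) * letter_sum k" by (simp add: letter_sum_def sum_distrib_left)
  finally show ?thesis .
qed

lemma sum_alphabet:
  "(\<Sum>c\<in>alphabet n. letter_weight a c * insert_prob q n c Z W) = (\<Sum>k=1..2*n. beta a k * pmf (right_jump q n k 1 Z) W)"
proof -
  have "(\<Sum>c\<in>alphabet n. letter_weight a c * insert_prob q n c Z W)
    = (\<Sum>l=1..n. letter_weight a (Unbarred l) * insert_prob q n (Unbarred l) Z W)
    + (\<Sum>l=1..n. letter_weight a (Barred l) * insert_prob q n (Barred l) Z W)"
    unfolding alphabet_def by (subst sum.union_disjoint) (auto simp: sum.reindex inj_on_def)
  also have "\<dots> = (\<Sum>k=1..2*n. beta a k * pmf (right_jump q n k 1 Z) W)"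
  proof -
    have "(\<Sum>l=1..N. a l * F (2 * l - 1)) + (\<Sum>l=1..N. inverse (a l) * F (2 * l)) = (\<Sum>k=1..2*N. beta a k * F k)" for N F
      by (induction N) (simp_all add: beta_def)
    then show ?thesis by (simp add: insert_prob_def)
  qed
  finally show ?thesis .
qed

lemma insertion_step:
  "(\<Sum>Z\<in>{Z\<in>KK n. Z (2 * n) = x}. (\<Prod>j=1..2*n. level_weight q a j Z) *
      (\<Sum>c\<in>alphabet n. letter_weight a c * insert_prob q n c Z W))
    = (\<Prod>j=1..2*n. level_weight q a j W) * L_kernel q n x (W (2 * n))"
proof -
  have "(\<Sum>Z\<in>{Z\<in>KK n. Z (2 * n) = x}. (\<Prod>j=1..2*n. level_weight q a j Z) *
      (\<Sum>c\<in>alphabet n. letter_weight a c * insert_prob q n c Z W))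
    = (\<Sum>k=1..2*n. \<Sum>Z\<in>{Z\<in>KK n. Z (2 * n) = x}. (\<Prod>j=1..2*n. level_weight q a j Z) *
        (beta a k * pmf (right_jump q n k 1 Z) W))"
    unfolding sum_alphabet sum_distrib_left by (rule sum.swap)
  also have "\<dots> = (\<Sum>k=1..2*n. below_weight (k - 1) * letter_sum k)"
    by (intro sum.cong refl insertion_letter_sum)
  also have "\<dots> = below_weight (2 * n) * L_kernel q n x (W (2 * n))"
    unfolding letter_sums[OF order_refl] even_sum_top ..
  finally show ?thesis by (simp add: below_weight_def)
qed

end

section \<open>The product of the level weights as pattern weight times kappa\<close>

lemma KK_interlace:
  assumes "Z \<in> KK n" "k < 2 * n"
  shows "interlace (Z k) (Z (Suc k))"
proof (cases "k = 0")
  case True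
  have "Z 0 = (\<lambda>i. 0)" using assms(1) by (simp add: KK_def)
  moreover have "Z 1 \<in> Lam 1" using KK_level[OF assms(1), of 1] assms(2) by (simp add: level_length_def)
  ultimately show ?thesis using True by (simp add: interlace_def Lam_def)
qed (use assms in \<open>auto simp: KK_def\<close>)

lemma step_weight_interlace:
  assumes b: "b \<noteq> 0" and xy: "interlace x y"
  shows "step_weight b q L (ints x) (ints y) = b powi (\<Sum>i=1..L. int (y i) - int (x i))
    * (\<Prod>i=1..L. q_binom q (y i - y (i + 1)) (y i - x i))"
proof (induction L)
  case 0
  then show ?case by (simp add: step_weight_def)
next
  case (Suc L)
  have le: "x (Suc L) \<le> y (Suc L)" "y (Suc (Suc L)) \<le> x (Suc L)" using xy by (auto simp: interlace_def)
  then have "nat (int (y (Suc L)) - int (y (Suc (Suc L)))) = y (Suc L) - y (Suc (Suc L))"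
    "nat (int (y (Suc L)) - int (x (Suc L))) = y (Suc L) - x (Suc L)" by auto
  then have "qw b q (ints y (Suc L) - ints y (Suc (Suc L))) (ints y (Suc L) - ints x (Suc L))
    = b powi (int (y (Suc L)) - int (x (Suc L))) * q_binom q (y (Suc L) - y (Suc (Suc L))) (y (Suc L) - x (Suc L))"
    using le by (simp add: qw_def qbin_def ints_def)
  then show ?case using Suc b
    by (simp add: step_weight_def power_int_add mult_ac)
qed

lemma prod_pairs:
  fixes g :: "nat \<Rightarrow> 'a::comm_monoid_mult"
  shows "(\<Prod>j=1..2*n. g j) = (\<Prod>k=1..n. g (2 * k - 1) * g (2 * k))"
  by (induction n) (simp_all add: mult.assoc)

text \<open>Levels 2k-1 and 2k yield the k-th factor: with inverse bases the exponents combine to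
  twice the size of the middle level minus its neighbours, and the last q-binomial at level 2k-1 is
  1 because level 2k-2 has no k-th entry.\<close>

lemma prod_level_weight:
  assumes q: "0 < q" "q < 1" and a: "\<And>i. i \<in> {1..n} \<Longrightarrow> a i > 0" and Z: "Z \<in> KK n"
  shows "(\<Prod>j=1..2*n. level_weight q a j Z) = pattern_weight n a Z * kappa q n Z"
  unfolding prod_pairs pattern_weight_def kappa_def prod.distrib[symmetric]
proof (rule prod.cong[OF refl])
  fix k assume k: "k \<in> {1..n}"
  then obtain l where l: "k = Suc l" by (cases k) auto
  have ak: "a k > 0" using a k by blast
  have lv: "level_length (2 * l) = l" "level_length (Suc (2 * l)) = k" "level_length (Suc (Suc (2 * l))) = k"
    by (auto simp: level_length_def l)
  define x where "x = Z (2 * l)"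
  define y where "y = Z (Suc (2 * l))"
  define z where "z = Z (Suc (Suc (2 * l)))"
  have xy: "interlace x y" and yz: "interlace y z"
    using KK_interlace[OF Z, of "2 * l"] KK_interlace[OF Z, of "Suc (2 * l)"] k l by (auto simp: x_def y_def z_def)
  have "x \<in> Lam l" "y \<in> Lam k" "z \<in> Lam k"
    using KK_level[OF Z, of "2 * l"] KK_level[OF Z, of "Suc (2 * l)"] KK_level[OF Z, of "Suc (Suc (2 * l))"] k l lv
    by (auto simp: x_def y_def z_def)
  then have 0: "x k = 0" "y (Suc k) = 0" "z (Suc k) = 0" by (auto simp: Lam_def l)
  have sz: "level_size Z (2 * l) = (\<Sum>i=1..k. int (x i))" "level_size Z (Suc (2 * l)) = (\<Sum>i=1..k. int (y i))"
    "level_size Z (Suc (Suc (2 * l))) = (\<Sum>i=1..k. int (z i))"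
    unfolding level_size_def lv using 0(1) by (simp_all add: x_def y_def z_def l)
  have "q_binom q (y k) (y k) = 1"
    using q_poch_nonzero[OF q] by (simp add: q_binom_def q_poch_def[of q 0])
  then have py: "(\<Prod>i=1..k. q_binom q (y i - y (i + 1)) (y i - x i)) = (\<Prod>i=1..k-1. q_binom q (y i - y (i + 1)) (y i - x i))"
    using 0 by (simp add: l)
  have pz: "(\<Prod>i=1..k. q_binom q (z i - z (i + 1)) (z i - y i))
    = (\<Prod>i=1..k-1. q_binom q (z i - z (i + 1)) (z i - y i)) * q_binom q (z k) (z k - y k)"
    using 0 by (simp add: l)
  have 1: "level_weight q a (Suc (2 * l)) Z = a k powi (level_size Z (Suc (2 * l)) - level_size Z (2 * l))
     * (\<Prod>i=1..k-1. q_binom q (y i - y (i + 1)) (y i - x i))"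
  proof -
    have "beta a (Suc (2 * l)) = a k" by (simp add: beta_def l)
    then show ?thesis using step_weight_interlace[OF _ xy, of "a k" q k] ak unfolding py sz
      by (simp add: level_weight_def lv x_def y_def sum_subtractf)
  qed
  have 2: "level_weight q a (Suc (Suc (2 * l))) Z = inverse (a k) powi (level_size Z (Suc (Suc (2 * l))) - level_size Z (Suc (2 * l)))
     * ((\<Prod>i=1..k-1. q_binom q (z i - z (i + 1)) (z i - y i)) * q_binom q (z k) (z k - y k))"
  proof -
    have "beta a (Suc (Suc (2 * l))) = inverse (a k)" by (simp add: beta_def l)
    then show ?thesis using step_weight_interlace[OF _ yz, of "inverse (a k)" q k] ak unfolding pz sz
      by (simp add: level_weight_def lv y_def z_def sum_subtractf)
  qed
  have "a k powi (s - r) * inverse (a k) powi (t - s) = a k powi (2 * s - t - r)" for r s t :: int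
  proof -
    have "inverse (a k) powi (t - s) = a k powi (s - t)"
      by (metis minus_diff_eq power_int_inverse power_int_minus)
    moreover have "a k powi (s - r) * a k powi (s - t) = a k powi (s - r + (s - t))"
      by (rule power_int_add[symmetric]) (use ak in simp)
    moreover have "s - r + (s - t) = 2 * s - t - r" by simp
    ultimately show ?thesis by (simp only:)
  qed
  note 3 = this[of "level_size Z (Suc (2 * l))" "level_size Z (2 * l)" "level_size Z (Suc (Suc (2 * l)))"]
  have e: "2 * k - 1 = Suc (2 * l)" "2 * k = Suc (Suc (2 * l))" "2 * k - 2 = 2 * l" by (simp_all add: l)
  show "level_weight q a (2 * k - 1) Z * level_weight q a (2 * k) Z =
     a k powi (2 * level_size Z (2 * k - 1) - level_size Z (2 * k) - level_size Z (2 * k - 2)) *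
     ((\<Prod>i=1..k-1. q_binom q (Z (2*k-1) i - Z (2*k-1) (i+1)) (Z (2*k-1) i - Z (2*k-2) i)
         * q_binom q (Z (2*k) i - Z (2*k) (i+1)) (Z (2*k) i - Z (2*k-1) i))
        * q_binom q (Z (2*k) k) (Z (2*k) k - Z (2*k-1) k))"
    unfolding e(1,3) unfolding e(2) 1 2 3[symmetric] prod.distrib x_def[symmetric] y_def[symmetric] z_def[symmetric]
    by (simp only: mult_ac)
qed

section \<open>Words and tableaux\<close>

text \<open>Splits off the last step, so that the last pattern but one becomes a summation
  variable.\<close>

lemma bij_betw_pattern_paths_Suc:
  assumes f0: "f ! 0 = (\<lambda>i. 0)" and Z: "Z (2 * n) = f ! Suc m"
  shows "bij_betw (\<lambda>(Z', zs). zs @ [Z])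
    (SIGMA Z':{Z'\<in>KK n. Z' (2 * n) = f ! m}. pattern_paths n m Z' f) (pattern_paths n (Suc m) Z f)"
proof -
  have up: "zs @ [Z] \<in> pattern_paths n (Suc m) Z f"
    if Z': "Z' \<in> KK n" "Z' (2 * n) = f ! m" and zs: "zs \<in> pattern_paths n m Z' f" for Z' zs
  proof -
    have len: "length zs = Suc m" and m: "zs ! m = Z'" using zs by (auto simp: pattern_paths_def)
    have "(zs @ [Z]) ! i \<in> KK n" if "i \<in> {1..<Suc m}" for i
      using zs Z' m len that by (cases "i = m") (auto simp: pattern_paths_def nth_append)
    moreover have "((zs @ [Z]) ! i) (2 * n) = f ! i" if "i \<in> {1..Suc m}" for i
      using zs Z len that by (cases "i = Suc m") (auto simp: pattern_paths_def nth_append)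
    ultimately show ?thesis using zs len by (auto simp: pattern_paths_def nth_append)
  qed
  have zero: "zero_pattern \<in> KK n"
    by (auto simp: zero_pattern_def KK_def Lam_def interlace_def)
  have down: "zs ! m \<in> KK n \<and> (zs ! m) (2 * n) = f ! m \<and> butlast zs \<in> pattern_paths n m (zs ! m) f
      \<and> butlast zs @ [Z] = zs"
    if zs: "zs \<in> pattern_paths n (Suc m) Z f" for zs
  proof -
    have len: "length zs = Suc (Suc m)" and z0: "zs ! 0 = zero_pattern" and last: "zs ! Suc m = Z"
      using zs by (auto simp: pattern_paths_def)
    \<comment> \<open>\<open>pattern_paths\<close> constrains only positive indices; for
      \<open>m = 0\<close> the entry is the zero pattern, which satisfies the constraints because
      f^0 is empty.\<close>
    have "zs ! m \<in> KK n \<and> (zs ! m) (2 * n) = f ! m"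
    proof (cases "m = 0")
      case True
      then show ?thesis using z0 zero f0 by (simp add: zero_pattern_def)
    next
      case False
      then show ?thesis using zs by (auto simp: pattern_paths_def)
    qed
    moreover have "butlast zs \<in> pattern_paths n m (zs ! m) f"
      using zs len by (auto simp: pattern_paths_def nth_butlast)
    moreover have "butlast zs @ [Z] = zs"
      using len last by (metis append_butlast_last_id diff_Suc_1 last_conv_nth length_0_conv nat.distinct(1))
    ultimately show ?thesis by blast
  qed
  have nth: "zs ! m = Z'" "length zs = Suc m" if "zs \<in> pattern_paths n m Z' f" for zs Z'
    using that by (auto simp: pattern_paths_def)
  show ?thesis
    using up down nth
    by (intro bij_betw_byWitness[where f' = "\<lambda>zs. (zs ! m, butlast zs)"]) (auto simp: nth_append)
qed

lemma phi_snoc: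
  assumes "f ! 0 = (\<lambda>i. 0)" "Z (2 * n) = f ! Suc (length w)"
  shows "phi q n (w @ [c]) Z f =
    (\<Sum>Z'\<in>{Z'\<in>KK n. Z' (2 * n) = f ! length w}. phi q n w Z' f * insert_prob q n c Z' Z)"
proof -
  let ?m = "length w"
  let ?K = "{Z'\<in>KK n. Z' (2 * n) = f ! ?m}"
  let ?g = "\<lambda>zs. \<Prod>i=1..Suc ?m. insert_prob q n ((w @ [c]) ! (i-1)) (zs ! (i-1)) (zs ! i)"
  have "phi q n (w @ [c]) Z f = sum ?g (pattern_paths n (Suc ?m) Z f)"
    by (simp add: phi_def)
  also have "\<dots> = (\<Sum>(Z', zs)\<in>(SIGMA Z':?K. pattern_paths n ?m Z' f). ?g (zs @ [Z]))"
    using sum.reindex_bij_betw[OF bij_betw_pattern_paths_Suc[of f Z n ?m, OF assms], of ?g] by (simp add: case_prod_unfold)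
  also have "\<dots> = (\<Sum>Z'\<in>?K. \<Sum>zs\<in>pattern_paths n ?m Z' f. ?g (zs @ [Z]))"
    by (intro sum.Sigma[symmetric] finite_KK_top ballI finite_pattern_paths)
  also have "\<dots> = (\<Sum>Z'\<in>?K. phi q n w Z' f * insert_prob q n c Z' Z)"
    unfolding phi_def sum_distrib_right
  proof (intro sum.cong refl)
    fix Z' zs assume zs: "zs \<in> pattern_paths n ?m Z' f"
    then have len: "length zs = Suc ?m" and last: "zs ! ?m = Z'" by (auto simp: pattern_paths_def)
    have "(\<Prod>i=1..?m. insert_prob q n ((w @ [c]) ! (i-1)) ((zs @ [Z]) ! (i-1)) ((zs @ [Z]) ! i))
      = (\<Prod>i=1..?m. insert_prob q n (w ! (i-1)) (zs ! (i-1)) (zs ! i))"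
      using len by (intro prod.cong) (auto simp: nth_append)
    then show "?g (zs @ [Z]) = (\<Prod>i=1..?m. insert_prob q n (w ! (i-1)) (zs ! (i-1)) (zs ! i)) * insert_prob q n c Z' Z"
      using len last by (simp add: nth_append)
  qed
  finally show ?thesis .
qed

lemma sum_words_Suc:
  "(\<Sum>w\<in>words n (Suc m). g w) = (\<Sum>w\<in>words n m. \<Sum>c\<in>alphabet n. g (w @ [c]))"
proof -
  have "bij_betw (\<lambda>(w, c). w @ [c]) (words n m \<times> alphabet n) (words n (Suc m))"
    by (rule bij_betw_byWitness[where f' = "\<lambda>w. (butlast w, last w)"])
      (auto simp: words_def length_Suc_conv_rev)
  from sum.reindex_bij_betw[OF this, of g] show ?thesis
    by (simp add: sum.cartesian_product case_prod_unfold)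
qed

lemma word_weight_snoc: "word_weight a (w @ [c]) = word_weight a w * letter_weight a c"
proof -
  have "(\<Prod>i<length w. letter_weight a ((w @ [c]) ! i)) = word_weight a w"
    unfolding word_weight_def by (intro prod.cong) (auto simp: nth_append)
  then show ?thesis by (simp add: word_weight_def)
qed

text \<open>Induction with \<open>Z\<close> arbitrary: removing the last letter leaves a sum over
  all patterns with level 2n equal to \<open>f ! m\<close>. The hypothesis evaluates the shorter
  words for each of them, and the intertwining relation then sums over the pattern and the last
  letter together.\<close>

lemma sum_words_phi:
  assumes q: "0 < q" "q < 1" and a: "\<And>i. i \<in> {1..n} \<Longrightarrow> a i > 0"
    and f0: "f ! 0 = (\<lambda>i. 0)" and f: "\<And>j. j \<le> m \<Longrightarrow> f ! j \<in> Lam n"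
    and Z: "Z \<in> KK n" "Z (2 * n) = f ! m"
  shows "(\<Sum>w\<in>words n m. word_weight a w * phi q n w Z f)
       = (\<Prod>j=1..2*n. level_weight q a j Z) * (\<Prod>i=1..m. L_kernel q n (f ! (i-1)) (f ! i))"
  using f Z
proof (induction m arbitrary: Z)
  case 0
  \<comment> \<open>Every entry is bounded by the first entry of level 2n, which is 0 here, so the
    empty word reaches only the zero pattern.\<close>
  have "Z k i = 0" for k i
  proof (cases "k \<le> 2 * n")
    case True
    then show ?thesis using KK_entry_le[OF 0(2) True, of i] 0(3) f0 by simp
  next
    case False
    then show ?thesis using 0(2) by (simp add: KK_def)
  qed
  then have "Z = zero_pattern" by (auto simp: zero_pattern_def)
  then have "pattern_paths n 0 Z f = {[zero_pattern]}"
    by (auto simp: pattern_paths_def length_Suc_conv)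
  moreover have "level_weight q a j zero_pattern = 1" for j
    by (simp add: level_weight_def step_weight_def ints_def zero_pattern_def qw_def qbin_def q_binom_def q_poch_def)
  moreover have "words n 0 = {[]}" by (auto simp: words_def)
  ultimately show ?case using \<open>Z = zero_pattern\<close>
    by (simp add: phi_def word_weight_def)
next
  case (Suc m)
  let ?K = "{Z'\<in>KK n. Z' (2 * n) = f ! m}"
  let ?P = "\<Prod>i=1..m. L_kernel q n (f ! (i-1)) (f ! i)"
  interpret insertion_step q n a Z "f ! m"
    using q a Suc.prems by unfold_locales auto
  have "(\<Sum>w\<in>words n (Suc m). word_weight a w * phi q n w Z f)
    = (\<Sum>w\<in>words n m. \<Sum>Z'\<in>?K. (word_weight a w * phi q n w Z' f) * (\<Sum>c\<in>alphabet n. letter_weight a c * insert_prob q n c Z' Z))"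
    unfolding sum_words_Suc
  proof (intro sum.cong refl)
    fix w assume "w \<in> words n m"
    then have "length w = m" by (simp add: words_def)
    then have "word_weight a (w @ [c]) * phi q n (w @ [c]) Z f
      = (\<Sum>Z'\<in>?K. (word_weight a w * phi q n w Z' f) * (letter_weight a c * insert_prob q n c Z' Z))" for c
      using phi_snoc[OF f0, of Z n w q c] Suc.prems(3)
      by (simp add: word_weight_snoc sum_distrib_left mult_ac)
    then show "(\<Sum>c\<in>alphabet n. word_weight a (w @ [c]) * phi q n (w @ [c]) Z f)
      = (\<Sum>Z'\<in>?K. (word_weight a w * phi q n w Z' f) * (\<Sum>c\<in>alphabet n. letter_weight a c * insert_prob q n c Z' Z))"
      unfolding sum_distrib_left by (simp add: sum.swap[of _ ?K])
  qed
  also have "\<dots> = (\<Sum>Z'\<in>?K. (\<Sum>w\<in>words n m. word_weight a w * phi q n w Z' f) * (\<Sum>c\<in>alphabet n. letter_weight a c * insert_prob q n c Z' Z))"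
    unfolding sum_distrib_right by (rule sum.swap)
  also have "\<dots> = (\<Sum>Z'\<in>?K. ?P * ((\<Prod>j=1..2*n. level_weight q a j Z') * (\<Sum>c\<in>alphabet n. letter_weight a c * insert_prob q n c Z' Z)))"
    using Suc.IH Suc.prems(1) by (intro sum.cong refl) simp
  also have "\<dots> = ?P * ((\<Prod>j=1..2*n. level_weight q a j Z) * L_kernel q n (f ! m) (Z (2 * n)))"
    unfolding sum_distrib_left[symmetric] insertion_step ..
  finally show ?case using Suc.prems(3) by simp
qed

theorem theorem4:
  fixes n m :: nat and q :: real and a :: "nat \<Rightarrow> real"
    and Z :: pattern and f :: "tuple list"
  assumes "n \<ge> 1" and "m \<ge> 1"
    and "0 < q" and "q < 1"
    and "\<And>i. i \<in> {1..n} \<Longrightarrow> a i > 0"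
    and "Z \<in> KK n" and "f \<in> osc_tableaux n m"
    and "Z (2 * n) = f ! m"
  shows "(\<Sum>w\<in>words n m. word_weight a w * phi q n w Z f)
       = pattern_weight n a Z * kappa q n Z * (\<Prod>i=1..m. L_kernel q n (f ! (i-1)) (f ! i))"
proof -
  have w: "(\<Prod>j=1..2*n. level_weight q a j Z) = pattern_weight n a Z * kappa q n Z"
    by (rule prod_level_weight) (use assms in auto)
  show ?thesis
    unfolding w[symmetric] by (rule sum_words_phi) (use assms in \<open>auto simp: osc_tableaux_def\<close>)
qed

end
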